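(* For every finite distributive lattice $(L,\le)$ there is a trivial computable probability measure $\mu$ on $2^\omega$ such that $$(\mathscr D_{LR(\mu)},\le_{LR(\mu)})\cong(L,\le)$$ as partially ordered sets.
   Context: $2^\omega$ is Cantor space (infinite binary sequences), $2^{<\omega}$ the set of finite binary strings, and $[\![\sigma]\!]$ the set of $X\in 2^\omega$ extending $\sigma$. A probability measure $\mu$ on $2^\omega$ is computable if $\sigma\mapsto\mu([\![\sigma]\!])$ is a computable real-valued function, i.e. there is a computable function $\widehat\mu:2^{<\omega}\times\omega\to\mathbb{Q}_2$ (dyadic rationals) with $|\mu([\![\sigma]\!])-\widehat\mu(\sigma,i)|\le 2^{-i}$ for all $\sigma,i$. $\mathsf{Atoms}_\mu=\{A\in 2^\omega:\mu(\{A\})>0\}$, and $\mu$ is trivial if $\mu(\mathsf{Atoms}_\mu)=1$. For $A\in 2^\omega$, a $\mu$-Martin-Löf test relative to $A$ is a sequence $(\mathcal U_i)_{i\in\omega}$ of uniformly $\Sigma^{0}_1$-in-$A$ subsets of $2^\omega$ with $\mu(\mathcal U_i)\le 2^{-i}$ for all $i$; $\mathsf{MLR}^A_\mu$ is the set of $X\in 2^\omega$ with $X\notin\bigcap_i\mathcal U_i$ for every such test. For $A,B\in 2^\omega$, $A\le_{LR(\mu)}B$ means $\mathsf{MLR}_\mu^B\subseteq\mathsf{MLR}_\mu^A$. This is a preorder on $2^\omega$; $\mathscr D_{LR(\mu)}$ denotes the set of equivalence classes of the induced equivalence relation ($A\le_{LR(\mu)}B$ and $B\le_{LR(\mu)}A$),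 partially ordered by the induced relation, also written $\le_{LR(\mu)}$. Lattices are nonempty, so a finite lattice has a top and a bottom element. *)

theory Defs
  imports "HOL-Probability.Probability" "HOL-Library.Nat_Bijection"
begin

section \<open>Cantor space\<close>

text \<open>The type \<open>nat \<Rightarrow> bool\<close> carries the product of the discrete topologies on \<open>bool\<close>; its
  Borel sets are generated by the cylinders.\<close>

type_synonym cantor = "nat \<Rightarrow> bool"

definition cylinder :: "bool list \<Rightarrow> cantor set" where
  "cylinder s = {X. \<forall>i<length s. X i = s ! i}"

lemma open_cylinder: "open (cylinder s)"
proof -
  have "cylinder s = (\<Inter>i\<in>{..<length s}. (\<lambda>X. X i) -` {s ! i})"
    by (auto simp: cylinder_def)
  moreover have "open ((\<lambda>X::cantor. X i) -` {b})" for i b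
    by (rule open_vimage[OF discrete_topology_class.open_discrete]) (rule continuous_on_product_coordinates)
  ultimately show ?thesis
    by (simp add: open_INT)
qed


section \<open>Relative computability\<close>

text \<open>Programs for the unary partial recursive functions relative to a set. Functions of several
  arguments take their arguments coded by the Cantor pairing function \<^const>\<open>prod_encode\<close>.\<close>

datatype program =
    Zero
  | Succ
  | First
  | Second
  | Query
  | Tuple program program
  | Compose program program
  | Recurse program program
  | Minimize program

primrec eval :: "cantor \<Rightarrow> program \<Rightarrow> nat \<Rightarrow> nat option" where
  "eval A Zero n = Some 0"
| "eval A Succ n = Some (Suc n)"
| "eval A First n = Some (fst (prod_decode n))"
| "eval A Second n = Some (snd (prod_decode n))"
| "eval A Query n = Some (of_bool (A n))"
| "eval A (Tuple p q) n =
     Option.bind (eval A p n) (\<lambda>x. Option.bind (eval A q n) (\<lambda>y. Some (prod_encode (x, y))))"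
| "eval A (Compose p q) n = Option.bind (eval A q n) (eval A p)"
| "eval A (Recurse p q) n =
     (case prod_decode n of (a, m) \<Rightarrow>
        rec_nat (eval A p a)
          (\<lambda>k r. Option.bind r (\<lambda>v. eval A q (prod_encode (a, prod_encode (k, v))))) m)"
| "eval A (Minimize p) n =
     (if \<exists>m. eval A p (prod_encode (n, m)) = Some 0 \<and>
             (\<forall>j<m. eval A p (prod_encode (n, j)) \<noteq> None)
      then Some (LEAST m. eval A p (prod_encode (n, m)) = Some 0)
      else None)"

definition string_code :: "bool list \<Rightarrow> nat" where
  "string_code s = list_encode (map of_bool s)"

text \<open>Every dyadic rational has a code (in fact infinitely many).\<close>

definition dyadic :: "nat \<Rightarrow> real" where
  "dyadic c = (case prod_decode c of (a, k) \<Rightarrow> of_int (int_decode a) / 2 ^ k)"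

text \<open>Computability without an oracle is computability relative to the empty set.\<close>

definition computable_dyadic :: "(bool list \<Rightarrow> nat \<Rightarrow> real) \<Rightarrow> bool" where
  "computable_dyadic f \<longleftrightarrow>
     (\<exists>p. \<forall>s i. \<exists>c. eval (\<lambda>_. False) p (prod_encode (string_code s, i)) = Some c \<and> dyadic c = f s i)"

text \<open>One program enumerates, uniformly in \<open>i\<close>, a set of strings c.e. in \<open>A\<close> (as the domain of a
  function partial computable in \<open>A\<close>) whose cylinders have union \<open>U i\<close>.\<close>

definition uniformly_Sigma1 :: "cantor \<Rightarrow> (nat \<Rightarrow> cantor set) \<Rightarrow> bool" where
  "uniformly_Sigma1 A U \<longleftrightarrow>
     (\<exists>p. \<forall>i. U i = (\<Union>s\<in>{s. eval A p (prod_encode (i, string_code s)) \<noteq> None}. cylinder s))"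


section \<open>Computable and trivial measures\<close>

definition computable_measure :: "cantor measure \<Rightarrow> bool" where
  "computable_measure \<mu> \<longleftrightarrow>
     (\<exists>f. computable_dyadic f \<and> (\<forall>s i. \<bar>measure \<mu> (cylinder s) - f s i\<bar> \<le> 1 / 2 ^ i))"

definition Atoms :: "cantor measure \<Rightarrow> cantor set" where
  "Atoms \<mu> = {A. measure \<mu> {A} > 0}"

definition trivial_measure :: "cantor measure \<Rightarrow> bool" where
  "trivial_measure \<mu> \<longleftrightarrow> measure \<mu> (Atoms \<mu>) = 1"


section \<open>Randomness and the LR-degrees\<close>

definition martin_loef_test :: "cantor measure \<Rightarrow> cantor \<Rightarrow> (nat \<Rightarrow> cantor set) \<Rightarrow> bool" where
  "martin_loef_test \<mu> A U \<longleftrightarrow> uniformly_Sigma1 A U \<and> (\<forall>i. measure \<mu> (U i) \<le> 1 / 2 ^ i)"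

definition MLR :: "cantor measure \<Rightarrow> cantor \<Rightarrow> cantor set" where
  "MLR \<mu> A = {X. \<forall>U. martin_loef_test \<mu> A U \<longrightarrow> X \<notin> (\<Inter>i. U i)}"

definition LR_le :: "cantor measure \<Rightarrow> cantor \<Rightarrow> cantor \<Rightarrow> bool" where
  "LR_le \<mu> A B \<longleftrightarrow> MLR \<mu> B \<subseteq> MLR \<mu> A"

definition LR_equiv :: "cantor measure \<Rightarrow> (cantor \<times> cantor) set" where
  "LR_equiv \<mu> = {(A, B). LR_le \<mu> A B \<and> LR_le \<mu> B A}"

lemma equiv_LR_equiv: "equiv UNIV (LR_equiv \<mu>)"
  by (auto simp: equiv_def refl_on_def sym_def trans_def LR_equiv_def LR_le_def)

definition LR_degrees :: "cantor measure \<Rightarrow> cantor set set" where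
  "LR_degrees \<mu> = UNIV // LR_equiv \<mu>"

definition LR_degree_le :: "cantor measure \<Rightarrow> cantor set \<Rightarrow> cantor set \<Rightarrow> bool" where
  "LR_degree_le \<mu> a b \<longleftrightarrow> (\<exists>A\<in>a. \<exists>B\<in>b. LR_le \<mu> A B)"

lemma LR_degree_le_class:
  "LR_degree_le \<mu> (LR_equiv \<mu> `` {A}) (LR_equiv \<mu> `` {B}) \<longleftrightarrow> LR_le \<mu> A B"
  by (auto simp: LR_degree_le_def LR_equiv_def LR_le_def)

definition order_isomorphic ::
    "'a set \<Rightarrow> ('a \<Rightarrow> 'a \<Rightarrow> bool) \<Rightarrow> 'b set \<Rightarrow> ('b \<Rightarrow> 'b \<Rightarrow> bool) \<Rightarrow> bool" where
  "order_isomorphic P leP Q leQ \<longleftrightarrow>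
     (\<exists>f. bij_betw f P Q \<and> (\<forall>x\<in>P. \<forall>y\<in>P. leP x y \<longleftrightarrow> leQ (f x) (f y)))"

end

theory Submission
  imports Defs
begin

text \<open>
  Let \<open>Z\<close> be the leftmost path avoiding a suitable universal test. It is Martin-Loef random for the
  fair coin measure even relative to parts of itself: the columns of \<open>Z\<close> in a finite set \<open>F\<close> do
  not derandomize the remaining columns (van Lambalgen). Moreover \<open>Z\<close> is the limit of a computable
  sequence \<open>Z\<^sub>s\<close>.

  For a set \<open>Q\<close> of columns, map \<open>W\<close> to the sequence \<open>\<Phi>\<^sub>Q(W)\<close> of stages at which the next digit of the
  \<open>Q\<close>-part of \<open>W\<close> is confirmed by \<open>Z\<^sub>s\<close>. As \<open>Z\<^sub>s\<close> converges, only the sequences that agree with \<open>Z\<close> on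
  \<open>Q\<close> are confirmed infinitely often, so the image of the coin measure is trivial: all points of its
  support other than \<open>\<Phi>\<^sub>Q(Z)\<close> are atoms. But tests can be translated along \<open>\<Phi>\<^sub>Q\<close>, so that \<open>\<Phi>\<^sub>Q(Z)\<close> is
  random relative to \<open>A\<close> iff the \<open>Q\<close>-part of \<open>Z\<close> is.

  Give each join prime \<open>j\<close> of the lattice its own column, and mix the measures for
  \<open>Q\<^sub>j = {k. k \<ge> j}\<close>. The set \<open>S\<^sub>A\<close> of those \<open>j\<close> whose point is not random relative to \<open>A\<close> determines
  the degree of \<open>A\<close>. It is a down-set because \<open>Q\<^sub>k \<subseteq> Q\<^sub>j\<close> for \<open>j \<le> k\<close>, and every down-set \<open>D\<close> is \<open>S\<^sub>A\<close> for
  the \<open>A\<close> that consists of the columns of \<open>Z\<close> in \<open>D\<close>. By Birkhoff's theorem the down-sets of join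
  primes form the lattice.
\<close>

section \<open>Computable functions on encoded types\<close>

class encodable =
  fixes enc :: "'a \<Rightarrow> nat"
  assumes inj_enc: "inj enc"

lemma enc_eq_iff [simp]: "enc x = enc y \<longleftrightarrow> x = y"
  by (simp add: inj_eq inj_enc)

instantiation nat :: encodable
begin
definition enc_nat [simp]: "enc (n::nat) = n"
instance by standard (simp add: inj_def)
end

instantiation bool :: encodable
begin
definition enc_bool [simp]: "enc (b::bool) = of_bool b"
instance by standard (auto simp: inj_def)
end

instantiation prod :: (encodable, encodable) encodable
begin
definition enc_prod [simp]: "enc x = prod_encode (enc (fst x), enc (snd x))"
instance by standard (auto simp: inj_def)
end

instantiation list :: (encodable) encodable
begin
definition enc_list: "enc xs = list_encode (map enc xs)"
instance
proof
  show "inj (enc :: 'a list \<Rightarrow> nat)"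
    by (rule injI) (simp add: enc_list list_encode_eq inj_map_eq_map inj_enc)
qed
end

lemma enc_Nil [simp]: "enc [] = 0"
  and enc_Cons [simp]: "enc (x # xs) = Suc (prod_encode (enc x, enc xs))"
  by (simp_all add: enc_list)

lemma enc_string: "enc (s :: bool list) = string_code s"
  by (simp add: enc_list string_code_def enc_bool[abs_def])

text \<open>Bounds the length by the code before \<open>length\<close> itself is known to be
  computable; \<open>computable_foldl\<close> takes its number of iterations from here.\<close>

lemma length_le_enc: "length xs \<le> enc xs"
proof (induction xs)
  case (Cons x xs)
  then show ?case using le_prod_encode_2[of "enc xs" "enc x"] by simp
qed simp

text \<open>The program is constrained only on numbers that are codes, so an encoding such as that
  of \<open>bool\<close> need not be surjective.\<close>

definition computable :: "cantor \<Rightarrow> ('a::encodable \<Rightarrow> 'b::encodable) \<Rightarrow> bool" where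
  "computable A f \<longleftrightarrow> (\<exists>p. \<forall>x. eval A p (enc x) = Some (enc (f x)))"

text \<open>The values of \<open>f\<close> and \<open>g\<close> may have different types. Maps that
  leave codes unchanged, such as \<open>prod_decode\<close> and \<open>list_decode\<close>, thereby
  become computable.\<close>

lemma computable_cong_enc:
  assumes "computable A f" "\<And>x. enc (g x) = enc (f x)"
  shows "computable A g"
  using assms by (simp add: computable_def)

lemma computable_cong:
  assumes "computable A f" "\<And>x. g x = f x"
  shows "computable A g"
  using assms by (simp add: computable_def)

lemma computable_const: "computable A (\<lambda>x. c)"
proof -
  have "\<exists>p. \<forall>x. eval A p x = Some n" for n
  proof (induction n)
    case 0
    show ?case by (rule exI[of _ Zero]) simp
  next
    case (Suc n)
    then obtain p where "\<forall>x. eval A p x = Some n" by blast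
    then show ?case by (intro exI[of _ "Compose Succ p"]) simp
  qed
  then show ?thesis unfolding computable_def by blast
qed

lemma computable_id: "computable A (\<lambda>x. x)"
  \<comment> \<open>Splitting a number and pairing its halves again serves as the identity
    program.\<close>
  unfolding computable_def by (rule exI[of _ "Tuple First Second"]) simp

lemma computable_comp:
  assumes "computable A f" "computable A g"
  shows "computable A (\<lambda>x. f (g x))"
proof -
  obtain p q where "\<forall>x. eval A p (enc x) = Some (enc (f x))" "\<forall>x. eval A q (enc x) = Some (enc (g x))"
    using assms unfolding computable_def by blast
  then show ?thesis
    unfolding computable_def by (intro exI[of _ "Compose p q"]) simp
qed

lemma computable_Pair:
  assumes "computable A f" "computable A g"
  shows "computable A (\<lambda>x. (f x, g x))"
proof -
  obtain p q where "\<forall>x. eval A p (enc x) = Some (enc (f x))" "\<forall>x. eval A q (enc x) = Some (enc (g x))"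
    using assms unfolding computable_def by blast
  then show ?thesis
    unfolding computable_def by (intro exI[of _ "Tuple p q"]) simp
qed

lemma computable_fst:
  assumes "computable A f"
  shows "computable A (\<lambda>x. fst (f x))"
proof (rule computable_comp[OF _ assms])
  show "computable A (fst :: 'b \<times> 'c \<Rightarrow> 'b)"
    unfolding computable_def by (rule exI[of _ First]) simp
qed

lemma computable_snd:
  assumes "computable A f"
  shows "computable A (\<lambda>x. snd (f x))"
proof (rule computable_comp[OF _ assms])
  show "computable A (snd :: 'b \<times> 'c \<Rightarrow> 'c)"
    unfolding computable_def by (rule exI[of _ Second]) simp
qed

lemma computable_Suc:
  assumes "computable A f"
  shows "computable A (\<lambda>x. Suc (f x))"
proof (rule computable_comp[OF _ assms])
  show "computable A Suc"
    unfolding computable_def by (rule exI[of _ Succ]) simp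
qed

lemma computable_oracle:
  assumes "computable A f"
  shows "computable A (\<lambda>x. A (f x))"
proof (rule computable_comp[OF _ assms])
  show "computable A (\<lambda>n. A n)"
    unfolding computable_def by (rule exI[of _ Query]) simp
qed

lemma computable_enc:
  assumes "computable A f"
  shows "computable A (\<lambda>x. enc (f x))"
  by (rule computable_cong_enc[OF assms]) simp

lemma computable_prod_encode:
  assumes "computable A f"
  shows "computable A (\<lambda>x. prod_encode (f x))"
  by (rule computable_cong_enc[OF assms]) simp

lemma computable_prod_decode:
  assumes "computable A f"
  shows "computable A (\<lambda>x. prod_decode (f x))"
  by (rule computable_cong_enc[OF assms]) simp

lemma computable_list_decode:
  assumes "computable A f"
  shows "computable A (\<lambda>x. list_decode (f x))"
  by (rule computable_cong_enc[OF assms]) (simp add: enc_list enc_nat[abs_def])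

text \<open>Functions with bound variables enter as unary functions of nested pairs, because
  \<open>computable\<close> speaks of one argument; the later closure rules follow this
  pattern.\<close>

lemma computable_rec_nat:
  assumes "computable A f" "computable A (\<lambda>y. g (fst y) (fst (snd y)) (snd (snd y)))" "computable A n"
  shows "computable A (\<lambda>x. rec_nat (f x) (\<lambda>k r. g x k r) (n x))"
proof -
  obtain p where p: "\<And>x. eval A p (enc x) = Some (enc (f x))"
    using assms(1) unfolding computable_def by blast
  obtain q where "\<forall>y. eval A q (enc y) = Some (enc (g (fst y) (fst (snd y)) (snd (snd y))))"
    using assms(2) unfolding computable_def by blast
  from this[rule_format, of "(x, k, r)" for x k r]
  have q: "eval A q (prod_encode (enc x, prod_encode (k, enc r))) = Some (enc (g x k r))" for x k r
    by simp
  have "eval A (Recurse p q) (prod_encode (enc x, m)) = Some (enc (rec_nat (f x) (g x) m))" for x m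
    by (induction m) (simp_all add: p q)
  then have "computable A (\<lambda>y. rec_nat (f (fst y)) (g (fst y)) (snd y))"
    unfolding computable_def by (intro exI[of _ "Recurse p q"]) (simp del: eval.simps)
  from computable_comp[OF this computable_Pair[OF computable_id assms(3)]] show ?thesis by simp
qed

lemma computable_If:
  assumes "computable A P" "computable A f" "computable A g"
  shows "computable A (\<lambda>x. if P x then f x else g x)"
proof -
  have P: "computable A (\<lambda>x. of_bool (P x) :: nat)"
    by (rule computable_cong_enc[OF assms(1)]) simp
  \<comment> \<open>A recursion of length 0 or 1 selects the branch.\<close>
  have "computable A (\<lambda>x. rec_nat (g x) (\<lambda>_ _. f x) (of_bool (P x)))"
    by (rule computable_rec_nat[OF assms(3) _ P]) 
      (rule computable_comp[OF assms(2)], intro computable_fst computable_id)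
  then show ?thesis
    by (rule computable_cong) simp
qed

lemma computable_not:
  assumes "computable A P"
  shows "computable A (\<lambda>x. \<not> P x)"
  using computable_If[OF assms computable_const[of A False] computable_const[of A True]]
  by (rule computable_cong) simp

lemma computable_conj:
  assumes "computable A P" "computable A Q"
  shows "computable A (\<lambda>x. P x \<and> Q x)"
  using computable_If[OF assms computable_const[of A False]]
  by (rule computable_cong) simp

lemma computable_imp:
  assumes "computable A P" "computable A Q"
  shows "computable A (\<lambda>x. P x \<longrightarrow> Q x)"
  using computable_If[OF assms computable_const[of A True]]
  by (rule computable_cong) simp

lemmas computable_basic =
  computable_id computable_const computable_Pair computable_fst computable_snd computable_Suc
  computable_oracle computable_enc computable_prod_encode computable_prod_decode computable_list_decode
  computable_rec_nat computable_If computable_not computable_conj computable_imp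

section \<open>Arithmetic and bounded quantifiers\<close>

lemma computable_pred:
  assumes "computable A f"
  shows "computable A (\<lambda>x. f x - Suc 0)"
proof -
  have "computable A (\<lambda>x. rec_nat 0 (\<lambda>k r. k) (f x))"
    by (intro computable_basic assms)
  moreover have "rec_nat 0 (\<lambda>k r. k) n = n - Suc 0" for n
    by (cases n) simp_all
  ultimately show ?thesis by simp
qed

lemma computable_add:
  assumes "computable A f" "computable A g"
  shows "computable A (\<lambda>x. f x + g x :: nat)"
proof -
  have "computable A (\<lambda>x. rec_nat (f x) (\<lambda>k r. Suc r) (g x))"
    by (intro computable_basic assms)
  moreover have "rec_nat m (\<lambda>k r. Suc r) n = m + n" for m n
    by (induction n) simp_all
  ultimately show ?thesis by simp
qed

lemma computable_diff:
  assumes "computable A f" "computable A g"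
  shows "computable A (\<lambda>x. f x - g x :: nat)"
proof -
  have "computable A (\<lambda>x. rec_nat (f x) (\<lambda>k r. r - Suc 0) (g x))"
    by (intro computable_basic computable_pred assms)
  moreover have "rec_nat m (\<lambda>k r. r - Suc 0) n = m - n" for m n
    by (induction n) simp_all
  ultimately show ?thesis by simp
qed

lemma computable_mult:
  assumes "computable A f" "computable A g"
  shows "computable A (\<lambda>x. f x * g x :: nat)"
proof -
  have "computable A (\<lambda>x. rec_nat 0 (\<lambda>k r. f x + r) (g x))"
    by (intro computable_basic computable_add assms computable_comp[OF assms(1)])
  moreover have "rec_nat 0 (\<lambda>k r. m + r) n = m * n" for m n :: nat
    by (induction n) simp_all
  ultimately show ?thesis by simp
qed

lemma computable_pow2:
  assumes "computable A f"
  shows "computable A (\<lambda>x. 2 ^ f x :: nat)"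
proof -
  have "computable A (\<lambda>x. rec_nat 1 (\<lambda>k r. 2 * r :: nat) (f x))"
    by (intro computable_basic computable_mult assms)
  moreover have "rec_nat (Suc 0) (\<lambda>k r. 2 * r) n = (2 ^ n :: nat)" for n
    by (induction n) simp_all
  ultimately show ?thesis by simp
qed

lemma computable_eq_0:
  assumes "computable A f"
  shows "computable A (\<lambda>x. f x = (0::nat))"
proof -
  have "computable A (\<lambda>x. rec_nat True (\<lambda>k r. False) (f x))"
    by (intro computable_basic assms)
  moreover have "rec_nat True (\<lambda>k r. False) n = (n = 0)" for n
    by (cases n) simp_all
  ultimately show ?thesis by simp
qed

lemma computable_le:
  assumes "computable A f" "computable A g"
  shows "computable A (\<lambda>x. f x \<le> (g x :: nat))"
  using computable_eq_0[OF computable_diff[OF assms]] by simp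

lemma computable_less:
  assumes "computable A f" "computable A g"
  shows "computable A (\<lambda>x. f x < (g x :: nat))"
  using computable_le[OF computable_Suc[OF assms(1)] assms(2)] by (simp add: Suc_le_eq)

lemma computable_eq:
  assumes "computable A f" "computable A g"
  shows "computable A (\<lambda>x. f x = g x)"
proof -
  have "computable A (\<lambda>x. enc (f x) \<le> enc (g x) \<and> enc (g x) \<le> enc (f x))"
    by (intro computable_basic computable_le assms)
  then show ?thesis by (rule computable_cong) auto
qed

lemma computable_All_less:
  assumes "computable A (n :: _ \<Rightarrow> nat)" "computable A (\<lambda>y. P (fst y) (snd y))"
  shows "computable A (\<lambda>x. \<forall>k<n x. P x k)"
proof -
  have "computable A (\<lambda>x. rec_nat True (\<lambda>k r. r \<and> P x k) (n x))"
    by (intro computable_basic assms(1)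
        computable_comp[OF assms(2), of "\<lambda>y. (fst y, fst (snd y))", simplified])
  moreover have "rec_nat True (\<lambda>k r. r \<and> Q k) m = (\<forall>k<m. Q k)" for Q m
    by (induction m) (auto simp: less_Suc_eq)
  ultimately show ?thesis by simp
qed

lemma computable_Ex_less:
  assumes "computable A (n :: _ \<Rightarrow> nat)" "computable A (\<lambda>y. P (fst y) (snd y))"
  shows "computable A (\<lambda>x. \<exists>k<n x. P x k)"
  using computable_not[OF computable_All_less[OF assms(1) computable_not[OF assms(2)]]] by simp

lemmas computable_arith = computable_basic computable_add computable_diff computable_mult computable_pow2
  computable_le computable_less computable_eq computable_All_less computable_Ex_less

section \<open>Operations on lists\<close>

lemma computable_case_list:
  assumes "computable A xs" "computable A f" "computable A (\<lambda>y. g (fst y) (fst (snd y)) (snd (snd y)))"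
  shows "computable A (\<lambda>x. case xs x of [] \<Rightarrow> f x | z # zs \<Rightarrow> g x z zs)"
proof -
  have "computable A (\<lambda>n::nat. n - Suc 0)" and "computable A (\<lambda>n::nat. n)"
    by (intro computable_pred computable_basic)+
  then obtain d where d: "\<And>n. eval A d n = Some (n - 1)"
    unfolding computable_def by auto
  obtain p where p: "\<And>x. eval A p (enc x) = Some (enc (f x))"
    using assms(2) unfolding computable_def by blast
  obtain q where "\<forall>y. eval A q (enc y) = Some (enc (g (fst y) (fst (snd y)) (snd (snd y))))"
    using assms(3) unfolding computable_def by blast
  from this[rule_format, of "(x, z, zs)" for x z zs]
  have q: "eval A q (prod_encode (enc x, prod_encode (enc z, enc zs))) = Some (enc (g x z zs))" for x z zs
    by simp
  \<comment> \<open>The recursion only tells zero from a successor. Its step takes head and tail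
    from the parameter and not from the counter, since \<open>q\<close> is specified on codes only
    and the smaller counter values need not be codes.\<close>
  let ?r = "Compose q (Tuple (Compose First First) (Compose d (Compose Second First)))"
  have step: "eval A (Recurse (Compose p First) ?r) (prod_encode (prod_encode (enc x, Suc (prod_encode (enc z, enc zs))), Suc m)) =
      Some (enc (g x z zs))" for x z zs m
    by (induction m) (simp_all add: p q d)
  have "eval A (Compose (Recurse (Compose p First) ?r) (Tuple (Tuple First Second) Second)) (enc (x, ys)) =
      Some (enc (case ys of [] \<Rightarrow> f x | z # zs \<Rightarrow> g x z zs))" for x ys
  proof (cases ys)
    case Nil
    then show ?thesis by (simp add: p)
  next
    case (Cons z zs)
    then show ?thesis using step[of x z zs "prod_encode (enc z, enc zs)"] by simp
  qed
  then have "computable A (\<lambda>y. case snd y of [] \<Rightarrow> f (fst y) | z # zs \<Rightarrow> g (fst y) z zs)"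
    unfolding computable_def
    by (intro exI[of _ "Compose (Recurse (Compose p First) ?r) (Tuple (Tuple First Second) Second)"])
      (metis prod.collapse)
  from computable_comp[OF this computable_Pair[OF computable_id assms(1)]] show ?thesis
    by (rule computable_cong) (simp split: list.split)
qed

lemma computable_Nil_Cons:
  assumes "computable A f" "computable A xs"
  shows "computable A (\<lambda>x. f x # xs x)"
  by (rule computable_cong_enc[of A "\<lambda>x. Suc (prod_encode (enc (f x), enc (xs x)))"])
    (intro computable_basic assms, simp)

text \<open>A step on pairs of accumulator and remaining list is iterated. It is stationary once the
  list is exhausted, so any bound on the length may serve as the number of iterations.\<close>

lemma computable_foldl:
  assumes "computable A a" "computable A (\<lambda>y. h (fst y) (fst (snd y)) (snd (snd y)))" "computable A xs"
  shows "computable A (\<lambda>x. foldl (\<lambda>r z. h x r z) (a x) (xs x))"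
proof -
  define step where "step h s = (case snd s of [] \<Rightarrow> s | z # zs \<Rightarrow> (h (fst s) z, zs))"
    for h :: "'b \<Rightarrow> 'c \<Rightarrow> 'b" and s
  have "computable A (\<lambda>x. fst (rec_nat (a x, xs x) (\<lambda>k s. step (h x) s) (enc (xs x))))"
    unfolding step_def
    by (intro computable_basic computable_case_list assms
        computable_comp[OF assms(2), of "\<lambda>y. (fst (fst y), fst (snd (snd (fst y))), fst (snd y))", simplified])
  moreover have "fst (rec_nat (r, ys) (\<lambda>k. step g) n) = foldl g r ys" if "length ys \<le> n" for r g n and ys :: "'c list"
  proof -
    have it: "rec_nat (r, ys) (\<lambda>k. step g) n = (step g ^^ n) (r, ys)" for n
      by (induction n) auto
    have "fst ((step g ^^ n) (r, ys)) = foldl g r ys"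
      using that
    proof (induction n arbitrary: r ys)
      case (Suc n)
      then show ?case
        by (cases ys) (simp_all add: funpow_swap1 step_def del: funpow.simps(2) add: funpow_Suc_right)
    qed simp
    then show ?thesis by (simp add: it)
  qed
  ultimately show ?thesis by (simp add: length_le_enc)
qed

lemma computable_rev:
  assumes "computable A xs"
  shows "computable A (\<lambda>x. rev (xs x))"
proof -
  have "computable A (\<lambda>x. foldl (\<lambda>r z. z # r) [] (xs x))"
    by (intro computable_basic computable_foldl computable_Nil_Cons assms)
  moreover have "foldl (\<lambda>r z. z # r) ys xs = rev xs @ ys" for ys and xs :: "'b list"
    by (induction xs arbitrary: ys) simp_all
  ultimately show ?thesis by simp
qed

lemma computable_append:
  assumes "computable A xs" "computable A ys"
  shows "computable A (\<lambda>x. xs x @ ys x)"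
proof -
  have "computable A (\<lambda>x. foldl (\<lambda>r z. z # r) (ys x) (rev (xs x)))"
    by (intro computable_basic computable_foldl computable_Nil_Cons computable_rev assms)
  moreover have "foldl (\<lambda>r z. z # r) ys xs = rev xs @ ys" for ys and xs :: "'b list"
    by (induction xs arbitrary: ys) simp_all
  ultimately show ?thesis by simp
qed

lemma computable_map:
  assumes "computable A (\<lambda>y. f (fst y) (snd y))" "computable A xs"
  shows "computable A (\<lambda>x. map (\<lambda>z. f x z) (xs x))"
proof -
  have "computable A (\<lambda>x. rev (foldl (\<lambda>r z. f x z # r) [] (xs x)))"
    by (intro computable_basic computable_foldl computable_Nil_Cons computable_rev assms
      computable_comp[OF assms(1), of "\<lambda>y. (fst y, snd (snd y))", simplified])
  moreover have "foldl (\<lambda>r z. g z # r) ys xs = rev (map g xs) @ ys" for ys and g :: "'b \<Rightarrow> 'c" and xs :: "'b list"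
    by (induction xs arbitrary: ys) simp_all
  ultimately show ?thesis by simp
qed

lemma computable_filter:
  assumes "computable A (\<lambda>y. P (fst y) (snd y))" "computable A xs"
  shows "computable A (\<lambda>x. filter (\<lambda>z. P x z) (xs x))"
proof -
  have "computable A (\<lambda>x. rev (foldl (\<lambda>r z. if P x z then z # r else r) [] (xs x)))"
    by (intro computable_basic computable_foldl computable_Nil_Cons computable_rev assms
      computable_comp[OF assms(1), of "\<lambda>y. (fst y, snd (snd y))", simplified])
  moreover have "foldl (\<lambda>r z. if Q z then z # r else r) ys xs = rev (filter Q xs) @ ys" for ys Q and xs :: "'b list"
    by (induction xs arbitrary: ys) simp_all
  ultimately show ?thesis by simp
qed

lemma computable_length:
  assumes "computable A xs"
  shows "computable A (\<lambda>x. length (xs x))"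
proof -
  have "computable A (\<lambda>x. foldl (\<lambda>r z. Suc r) 0 (xs x))"
    by (intro computable_basic computable_foldl assms)
  moreover have "foldl (\<lambda>r z. Suc r) n xs = length xs + n" for n and xs :: "'b list"
    by (induction xs arbitrary: n) simp_all
  ultimately show ?thesis by simp
qed

lemma computable_sum_list:
  assumes "computable A xs"
  shows "computable A (\<lambda>x. sum_list (xs x) :: nat)"
proof -
  have "computable A (\<lambda>x. foldl (\<lambda>r z. r + z) 0 (xs x))"
    by (intro computable_basic computable_foldl computable_add assms)
  moreover have "foldl (\<lambda>r z. r + z) n xs = n + sum_list xs" for n :: nat and xs
    by (induction xs arbitrary: n) simp_all
  ultimately show ?thesis by simp
qed

lemma computable_Ball_set:
  assumes "computable A (\<lambda>y. P (fst y) (snd y))" "computable A xs"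
  shows "computable A (\<lambda>x. \<forall>z\<in>set (xs x). P x z)"
proof -
  have "computable A (\<lambda>x. foldl (\<lambda>r z. r \<and> P x z) True (xs x))"
    by (intro computable_basic computable_foldl assms
      computable_comp[OF assms(1), of "\<lambda>y. (fst y, snd (snd y))", simplified])
  moreover have "foldl (\<lambda>r z. r \<and> Q z) b xs = (b \<and> (\<forall>z\<in>set xs. Q z))" for b Q and xs :: "'b list"
    by (induction xs arbitrary: b) auto
  ultimately show ?thesis by simp
qed

lemma computable_Bex_set:
  assumes "computable A (\<lambda>y. P (fst y) (snd y))" "computable A xs"
  shows "computable A (\<lambda>x. \<exists>z\<in>set (xs x). P x z)"
  using computable_not[OF computable_Ball_set[OF computable_not[OF assms(1)] assms(2)]] by simp

lemma computable_in_set: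
  assumes "computable A f" "computable A xs"
  shows "computable A (\<lambda>x. f x \<in> set (xs x))"
proof -
  have "computable A (\<lambda>x. \<exists>z\<in>set (xs x). z = f x)"
    by (intro computable_Bex_set computable_eq computable_basic computable_comp[OF assms(1)] assms)
  then show ?thesis by simp
qed

lemma computable_upt:
  assumes "computable A n"
  shows "computable A (\<lambda>x. [0..<n x])"
proof -
  have "computable A (\<lambda>x. rec_nat [] (\<lambda>k r. r @ [k]) (n x))"
    by (intro computable_basic computable_append computable_Nil_Cons assms)
  moreover have "rec_nat [] (\<lambda>k r. r @ [k]) m = [0..<m]" for m
    by (induction m) simp_all
  ultimately show ?thesis by simp
qed

lemma computable_drop:
  assumes "computable A n" "computable A xs"
  shows "computable A (\<lambda>x. drop (n x) (xs x))"
proof -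
  have "computable A (\<lambda>x. rec_nat (xs x) (\<lambda>k r. case r of [] \<Rightarrow> [] | z # zs \<Rightarrow> zs) (n x))"
    by (intro computable_basic computable_case_list assms)
  moreover have "rec_nat ys (\<lambda>k r. case r of [] \<Rightarrow> [] | z # zs \<Rightarrow> zs) m = drop m ys" for m and ys :: "'b list"
  proof (induction m)
    case (Suc m)
    have "drop (Suc m) ys = tl (drop m ys)" by (simp add: drop_Suc tl_drop)
    with Suc show ?case by (cases "drop m ys") simp_all
  qed simp
  ultimately show ?thesis by simp
qed

lemma computable_take:
  assumes "computable A n" "computable A xs"
  shows "computable A (\<lambda>x. take (n x) (xs x))"
proof -
  have "computable A (\<lambda>x. rev (drop (length (xs x) - n x) (rev (xs x))))"
    by (intro computable_arith computable_rev computable_drop computable_length assms)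
  moreover have "rev (drop (length ys - m) (rev ys)) = take m ys" for m and ys :: "'b list"
    by (cases "m \<le> length ys") (simp_all add: rev_drop)
  ultimately show ?thesis by simp
qed

text \<open>\<open>nth_default\<close> stands in for \<open>!\<close>, whose value beyond the end of
  the list is unspecified.\<close>

lemma computable_nth_default:
  assumes "computable A d" "computable A xs" "computable A i"
  shows "computable A (\<lambda>x. nth_default (d x) (xs x) (i x))"
proof -
  have "computable A (\<lambda>x. case drop (i x) (xs x) of [] \<Rightarrow> d x | z # zs \<Rightarrow> z)"
    by (intro computable_basic computable_case_list computable_drop assms)
  moreover have "(case drop j ys of [] \<Rightarrow> c | z # zs \<Rightarrow> z) = nth_default c ys j" for j c and ys :: "'b list"
    by (cases "j < length ys") (simp_all add: nth_default_def flip: Cons_nth_drop_Suc)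
  ultimately show ?thesis by simp
qed

lemma computable_concat:
  assumes "computable A xs"
  shows "computable A (\<lambda>x. concat (xs x))"
proof -
  have "computable A (\<lambda>x. foldl (\<lambda>r z. r @ z) [] (xs x))"
    by (intro computable_basic computable_foldl computable_append assms)
  moreover have "foldl (\<lambda>r z. r @ z) ys xs = ys @ concat xs" for ys :: "'b list" and xs
    by (induction xs arbitrary: ys) simp_all
  ultimately show ?thesis by simp
qed

lemma computable_n_lists:
  assumes "computable A n"
  shows "computable A (\<lambda>x. List.n_lists (n x) bs)"
proof -
  have "computable A (\<lambda>x. rec_nat [[]] (\<lambda>k r. concat (map (\<lambda>ys. map (\<lambda>y. y # ys) bs) r)) (n x))"
    by (intro computable_basic computable_concat computable_map computable_Nil_Cons assms)
  moreover have "rec_nat [[]] (\<lambda>k r. concat (map (\<lambda>ys. map (\<lambda>y. y # ys) bs) r)) m = List.n_lists m bs" for m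
    by (induction m) simp_all
  ultimately show ?thesis by simp
qed

lemmas computable_intros = computable_arith computable_Nil_Cons computable_rev computable_append computable_map
  computable_filter computable_length computable_sum_list computable_Ball_set computable_Bex_set computable_in_set
  computable_upt computable_drop computable_take computable_nth_default
  computable_concat computable_n_lists

section \<open>Enumerating halting computations from finite oracles\<close>

text \<open>Builds new tests from old ones: strings are filtered by a decidable condition and then
  translated. \<open>Minimize r\<close> searches for a zero of a function that ignores the search
  variable, so it stops at once or never.\<close>

lemma eval_None_restrict:
  assumes "computable A P" "computable A f"
  shows "\<exists>q. \<forall>x. eval A q (enc x) \<noteq> None \<longleftrightarrow> P x \<and> eval A p (enc (f x)) \<noteq> None"
proof -
  have "computable A (\<lambda>y::'a \<times> nat. \<not> P (fst y))"
    by (intro computable_intros computable_comp[OF assms(1)])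
  then obtain r where "\<forall>y::'a \<times> nat. eval A r (enc y) = Some (enc (\<not> P (fst y)))"
    unfolding computable_def by blast
  from this[rule_format, of "(x, k)" for x k]
  have r: "eval A r (prod_encode (enc x, k)) = Some (of_bool (\<not> P x))" for x k
    by simp
  have min: "eval A (Minimize r) (enc x) = (if P x then Some 0 else None)" for x
    by (simp add: r)
  obtain c where c: "\<And>x. eval A c (enc x) = Some (enc (f x))"
    using assms(2) unfolding computable_def by blast
  \<comment> \<open>Pairing the input with the search and projecting back returns the input exactly
    when the search stops.\<close>
  have "eval A (Compose (Compose p c) (Compose First (Tuple (Tuple First Second) (Minimize r)))) (enc x) \<noteq> None
      \<longleftrightarrow> P x \<and> eval A p (enc (f x)) \<noteq> None" for x
    by (simp add: min c del: eval.simps(9))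
  then show ?thesis by blast
qed

definition pre :: "(nat \<Rightarrow> 'a) \<Rightarrow> nat \<Rightarrow> 'a list" where
  "pre X t = map X [0..<t]"

lemma length_pre [simp]: "length (pre X t) = t"
  and nth_pre [simp]: "k < t \<Longrightarrow> pre X t ! k = X k"
  by (simp_all add: pre_def)

lemma take_pre [simp]: "take l (pre X t) = pre X (min l t)"
  by (simp add: pre_def take_map min_def)

lemma pre_eq_iff: "pre X t = pre Y t \<longleftrightarrow> (\<forall>k<t. X k = Y k)"
  by (auto simp: pre_def)

lemma cylinder_pre: "X \<in> cylinder s \<longleftrightarrow> pre X (length s) = s"
  by (auto simp: cylinder_def list_eq_iff_nth_eq)

section \<open>A derivation system for the values of programs\<close>

primrec code :: "program \<Rightarrow> nat" where
  "code Zero = prod_encode (0, 0)"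
| "code Succ = prod_encode (1, 0)"
| "code First = prod_encode (2, 0)"
| "code Second = prod_encode (3, 0)"
| "code Query = prod_encode (4, 0)"
| "code (Tuple p q) = prod_encode (5, prod_encode (code p, code q))"
| "code (Compose p q) = prod_encode (6, prod_encode (code p, code q))"
| "code (Recurse p q) = prod_encode (7, prod_encode (code p, code q))"
| "code (Minimize p) = prod_encode (8, code p)"

type_synonym judgement = "nat \<times> nat \<times> nat"

text \<open>A judgement \<open>(c, x, y)\<close> states that the program with code \<open>c\<close> maps \<open>x\<close> to \<open>y\<close>. With
  \<open>c = prod_encode (9, code p)\<close>, \<open>x = prod_encode (n, m)\<close> and \<open>y = 0\<close> it states instead that the search
  of \<open>Minimize p\<close> on \<open>n\<close> passes beyond all \<open>j < m\<close>. In this way every rule has at most two premises.\<close>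

definition infer :: "bool list \<Rightarrow> nat \<Rightarrow> nat \<Rightarrow> judgement \<Rightarrow> judgement \<Rightarrow> judgement" where
  "infer \<sigma> r k f g =
    (if r = 2 then (prod_encode (1, 0), k, Suc k)
     else if r = 3 then (prod_encode (2, 0), k, fst (prod_decode k))
     else if r = 4 then (prod_encode (3, 0), k, snd (prod_decode k))
     else if r = 5 \<and> k < length \<sigma> then (prod_encode (4, 0), k, enc (nth_default False \<sigma> k))
     else if r = 6 \<and> fst (snd f) = fst (snd g) then
       (prod_encode (5, prod_encode (fst f, fst g)), fst (snd f), prod_encode (snd (snd f), snd (snd g)))
     else if r = 7 \<and> snd (snd f) = fst (snd g) then
       (prod_encode (6, prod_encode (fst g, fst f)), fst (snd f), snd (snd g))
     else if r = 8 then
       (prod_encode (7, prod_encode (fst f, k)), prod_encode (fst (snd f), 0), snd (snd f))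
     else if r = 9 \<and> fst (prod_decode (fst f)) = 7 \<and> snd (prod_decode (snd (prod_decode (fst f)))) = fst g
         \<and> fst (snd g) = prod_encode (fst (prod_decode (fst (snd f))),
             prod_encode (snd (prod_decode (fst (snd f))), snd (snd f))) then
       (fst f, prod_encode (fst (prod_decode (fst (snd f))), Suc (snd (prod_decode (fst (snd f))))), snd (snd g))
     else if r = 10 then (prod_encode (9, fst (prod_decode k)), prod_encode (snd (prod_decode k), 0), 0)
     else if r = 11 \<and> fst f = prod_encode (9, fst g) \<and> fst (snd f) = fst (snd g) \<and> snd (snd g) \<noteq> 0 then
       (fst f, prod_encode (fst (prod_decode (fst (snd f))), Suc (snd (prod_decode (fst (snd f))))), 0)
     else if r = 12 \<and> fst f = prod_encode (9, fst g) \<and> fst (snd f) = fst (snd g) \<and> snd (snd g) = 0 then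
       (prod_encode (8, fst g), fst (prod_decode (fst (snd f))), snd (prod_decode (fst (snd f))))
     else (prod_encode (0, 0), k, 0))"

text \<open>Judgements about numbers that code no program are vacuously sound. Hence rules need not
  check codes, and rule 8 may guess the code of the step program.\<close>

definition sound :: "cantor \<Rightarrow> judgement \<Rightarrow> bool" where
  "sound A f \<longleftrightarrow>
     (\<forall>p. fst f = code p \<longrightarrow> eval A p (fst (snd f)) = Some (snd (snd f))) \<and>
     (\<forall>p. fst f = prod_encode (9, code p) \<longrightarrow>
        (\<forall>j < snd (prod_decode (fst (snd f))).
           \<exists>v. eval A p (prod_encode (fst (prod_decode (fst (snd f))), j)) = Some (Suc v)))"

lemma code_tag: "fst (prod_decode (code p)) \<noteq> 9"
  by (cases p) auto

lemma soundI_code: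
  assumes "\<And>p. c = code p \<Longrightarrow> eval A p x = Some y" "fst (prod_decode c) \<noteq> 9"
  shows "sound A (c, x, y)"
  using assms by (auto simp: sound_def)

lemma sound_triv: "sound A (prod_encode (0, 0), k, 0)"
proof (rule soundI_code)
  show "eval A p k = Some 0" if "prod_encode (0, 0) = code p" for p
    using that by (cases p) auto
qed simp

text \<open>The numbered facts in the proof treat the rules of \<open>infer\<close> with the same
  numbers.\<close>

lemma sound_infer:
  assumes \<sigma>: "\<And>k. k < length \<sigma> \<Longrightarrow> \<sigma> ! k = A k" and f: "sound A f" and g: "sound A g"
  shows "sound A (infer \<sigma> r k f g)"
proof -
  obtain c x y where f_eq: "f = (c, x, y)" by (cases f)
  obtain d u v where g_eq: "g = (d, u, v)" by (cases g)
  have fc: "eval A p x = Some y" if "c = code p" for p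
    using f that by (simp add: sound_def f_eq)
  have fm: "\<exists>w. eval A p (prod_encode (n, j)) = Some (Suc w)"
    if "c = prod_encode (9, code p)" "x = prod_encode (n, m)" "j < m" for p n m j
    using f that by (simp add: sound_def f_eq)
  have gc: "eval A p u = Some v" if "d = code p" for p
    using g that by (simp add: sound_def g_eq)
  obtain n m where x: "x = prod_encode (n, m)"
    by (metis prod_decode_inverse surj_pair)
  have 2: "sound A (prod_encode (1, 0), k, Suc k)"
  proof (rule soundI_code)
    show "eval A p k = Some (Suc k)" if "prod_encode (1, 0) = code p" for p
      using that by (cases p) auto
  qed simp
  have 3: "sound A (prod_encode (2, 0), k, fst (prod_decode k))"
  proof (rule soundI_code)
    show "eval A p k = Some (fst (prod_decode k))" if "prod_encode (2, 0) = code p" for p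
      using that by (cases p) auto
  qed simp
  have 4: "sound A (prod_encode (3, 0), k, snd (prod_decode k))"
  proof (rule soundI_code)
    show "eval A p k = Some (snd (prod_decode k))" if "prod_encode (3, 0) = code p" for p
      using that by (cases p) auto
  qed simp
  have 5: "sound A (prod_encode (4, 0), k, enc (nth_default False \<sigma> k))" if "k < length \<sigma>"
  proof (rule soundI_code)
    show "eval A p k = Some (enc (nth_default False \<sigma> k))" if "prod_encode (4, 0) = code p" for p
      using that \<sigma>[OF \<open>k < length \<sigma>\<close>] \<open>k < length \<sigma>\<close> by (cases p) (auto simp: nth_default_def)
  qed simp
  have 6: "sound A (prod_encode (5, prod_encode (c, d)), x, prod_encode (y, v))" if "x = u"
  proof (rule soundI_code)
    show "eval A p x = Some (prod_encode (y, v))" if "prod_encode (5, prod_encode (c, d)) = code p" for p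
      using that fc gc \<open>x = u\<close> by (cases p) auto
  qed simp
  have 7: "sound A (prod_encode (6, prod_encode (d, c)), x, v)" if "y = u"
  proof (rule soundI_code)
    show "eval A p x = Some v" if "prod_encode (6, prod_encode (d, c)) = code p" for p
      using that fc gc \<open>y = u\<close> by (cases p) auto
  qed simp
  have 8: "sound A (prod_encode (7, prod_encode (c, k)), prod_encode (x, 0), y)"
  proof (rule soundI_code)
    show "eval A p (prod_encode (x, 0)) = Some y" if "prod_encode (7, prod_encode (c, k)) = code p" for p
      using that fc by (cases p) auto
  qed simp
  have 9: "sound A (c, prod_encode (n, Suc m), v)"
    if "fst (prod_decode c) = 7" "snd (prod_decode (snd (prod_decode c))) = d"
      "u = prod_encode (n, prod_encode (m, y))"
  proof (rule soundI_code)
    show "eval A p (prod_encode (n, Suc m)) = Some v" if "c = code p" for p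
    proof (cases p)
      case (Recurse p1 p2)
      then have "d = code p2"
        using that \<open>snd (prod_decode (snd (prod_decode c))) = d\<close> by simp
      from gc[OF this] fc[OF that] show ?thesis
        by (simp add: Recurse x \<open>u = _\<close>)
    qed (use that \<open>fst (prod_decode c) = 7\<close> in auto)
  qed (use that in simp)
  have 10: "sound A (prod_encode (9, i), prod_encode (j, 0), 0)" for i j
    unfolding sound_def using code_tag by (auto dest: arg_cong[where f="\<lambda>n. fst (prod_decode n)"])
  have 11: "sound A (c, prod_encode (n, Suc m), 0)" if "c = prod_encode (9, d)" "x = u" "v \<noteq> 0"
  proof -
    have "\<exists>w. eval A p (prod_encode (n, j)) = Some (Suc w)" if "d = code p" "j < Suc m" for p j
    proof (cases "j = m")
      case True
      then show ?thesis using gc[OF \<open>d = code p\<close>] \<open>x = u\<close> x \<open>v \<noteq> 0\<close> not0_implies_Suc by auto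
    next
      case False
      then show ?thesis using fm[of p n m j] that x \<open>c = _\<close> by simp
    qed
    then show ?thesis
      unfolding sound_def using code_tag that(1)
      by (auto dest: arg_cong[where f="\<lambda>n. fst (prod_decode n)"])
  qed
  have 12: "sound A (prod_encode (8, d), n, m)" if "c = prod_encode (9, d)" "x = u" "v = 0"
  proof (rule soundI_code)
    show "eval A p n = Some m" if "prod_encode (8, d) = code p" for p
    proof (cases p)
      case (Minimize q)
      then have d: "d = code q" using that by simp
      have 0: "eval A q (prod_encode (n, m)) = Some 0" using gc[OF d] \<open>x = u\<close> \<open>v = 0\<close> x by simp
      have S: "\<exists>w. eval A q (prod_encode (n, j)) = Some (Suc w)" if "j < m" for j
        using fm[of q n m j] that d \<open>c = _\<close> x by simp
      have "(LEAST m. eval A q (prod_encode (n, m)) = Some 0) = m"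
      proof (rule Least_equality)
        show "m \<le> j" if "eval A q (prod_encode (n, j)) = Some 0" for j
          using S[of j] that by (cases "j < m") auto
      qed (fact 0)
      moreover have "\<forall>j<m. eval A q (prod_encode (n, j)) \<noteq> None" using S by fastforce
      ultimately show ?thesis using 0 by (auto simp: Minimize)
    qed (use that in auto)
  qed simp
  show ?thesis
    unfolding infer_def f_eq g_eq fst_conv snd_conv
    using 2 3 4 5 6 7 8 9 10 11 12 sound_triv by (auto simp: x split: if_splits)
qed

text \<open>Entry \<open>t\<close> attempts the inference coded by \<open>t\<close>:
  \<open>t\<close> decodes to \<open>(r, (i, (j, k)))\<close>, and rule \<open>r\<close> is applied
  to entries \<open>i\<close> and \<open>j\<close> with parameter \<open>k\<close>. A premise that
  is not yet available is replaced by a trivial judgement.\<close>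

primrec facts :: "bool list \<Rightarrow> nat \<Rightarrow> judgement list" where
  "facts \<sigma> 0 = []"
| "facts \<sigma> (Suc t) = facts \<sigma> t @ [infer \<sigma> (fst (prod_decode t))
     (snd (prod_decode (snd (prod_decode (snd (prod_decode t))))))
     (nth_default (prod_encode (0, 0), 0, 0) (facts \<sigma> t) (fst (prod_decode (snd (prod_decode t)))))
     (nth_default (prod_encode (0, 0), 0, 0) (facts \<sigma> t) (fst (prod_decode (snd (prod_decode (snd (prod_decode t)))))))]"

lemma length_facts [simp]: "length (facts \<sigma> t) = t"
  by (induction t) auto

lemma sound_facts:
  assumes "\<And>k. k < length \<sigma> \<Longrightarrow> \<sigma> ! k = A k" "f \<in> set (facts \<sigma> t)"
  shows "sound A f"
  using assms(2)
proof (induction t arbitrary: f)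
  case (Suc t)
  have "sound A (nth_default (prod_encode (0, 0), 0, 0) (facts \<sigma> t) i)" for i
    using Suc.IH[of "facts \<sigma> t ! i"] sound_triv[of A 0] by (auto simp: nth_default_def)
  then have *: "sound A (infer \<sigma> r k (nth_default (prod_encode (0, 0), 0, 0) (facts \<sigma> t) i)
      (nth_default (prod_encode (0, 0), 0, 0) (facts \<sigma> t) j))" for r k i j
    by (intro sound_infer assms(1))
  show ?case
  proof (cases "f \<in> set (facts \<sigma> t)")
    case True
    then show ?thesis by (rule Suc.IH)
  next
    case False
    then show ?thesis using Suc.prems * by (simp del: split_paired_All)
  qed
qed simp

lemma nth_facts: "i < t \<Longrightarrow> t \<le> t' \<Longrightarrow> facts \<sigma> t' ! i = facts \<sigma> t ! i"
proof (induction t')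
  case (Suc t')
  show ?case
  proof (cases "t = Suc t'")
    case False
    then show ?thesis using Suc by (simp add: nth_append)
  qed simp
qed simp

definition fact :: "bool list \<Rightarrow> nat \<Rightarrow> judgement" where
  "fact \<sigma> t = facts \<sigma> (Suc t) ! t"

text \<open>For \<open>r > 0\<close> the code of an inference exceeds the numbers of its premises,
  so both are already in the list and the default value is not taken.\<close>

lemma fact_eq_infer:
  assumes "r > 0"
  shows "fact \<sigma> (prod_encode (r, prod_encode (i, prod_encode (j, k)))) = infer \<sigma> r k (fact \<sigma> i) (fact \<sigma> j)"
    (is "fact \<sigma> ?t = _")
proof -
  have less: "n < prod_encode (r, n)" for n
  proof -
    have "m \<le> triangle m" for m by (induction m) simp_all
    from this[of "r + n"] show ?thesis using assms by (simp add: prod_encode_def)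
  qed
  have ij: "i < ?t" "j < ?t"
    using less[of "prod_encode (i, prod_encode (j, k))"] le_prod_encode_1[of i "prod_encode (j, k)"]
      le_prod_encode_2[of "prod_encode (j, k)" i] le_prod_encode_1[of j k]
    by linarith+
  then have "facts \<sigma> ?t ! i = fact \<sigma> i" "facts \<sigma> ?t ! j = fact \<sigma> j"
    unfolding fact_def by (intro nth_facts; simp)+
  with ij show ?thesis
    by (subst fact_def) (simp add: nth_append nth_default_def)
qed

text \<open>Monotonicity in the oracle string fails for single facts, since a query beyond the string
  yields a trivial fact; it is only required from some length on.\<close>

definition derivable :: "cantor \<Rightarrow> judgement \<Rightarrow> bool" where
  "derivable A f \<longleftrightarrow> (\<exists>t L. \<forall>l\<ge>L. fact (pre A l) t = f)"

lemma derivable_infer: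
  assumes "r > 0" "derivable A f" "derivable A g" "\<And>l. l \<ge> L \<Longrightarrow> infer (pre A l) r k f g = h"
  shows "derivable A h"
proof -
  obtain i L1 where i: "\<And>l. l \<ge> L1 \<Longrightarrow> fact (pre A l) i = f"
    using assms(2) unfolding derivable_def by blast
  obtain j L2 where j: "\<And>l. l \<ge> L2 \<Longrightarrow> fact (pre A l) j = g"
    using assms(3) unfolding derivable_def by blast
  have "fact (pre A l) (prod_encode (r, prod_encode (i, prod_encode (j, k)))) = h"
    if "l \<ge> max L (max L1 L2)" for l
    using that by (simp add: fact_eq_infer assms(1,4) i j)
  then show ?thesis unfolding derivable_def by blast
qed

lemma derivable_triv: "derivable A (prod_encode (0, 0), k, 0)"
  unfolding derivable_def
proof (intro exI allI impI)
  \<comment> \<open>Number 1 matches no clause of \<open>infer\<close>, so the trivial judgement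
    results.\<close>
  show "fact (pre A l) (prod_encode (1, prod_encode (0, prod_encode (0, k)))) = (prod_encode (0, 0), k, 0)" for l
    by (subst fact_eq_infer) (simp_all add: infer_def)
qed

text \<open>Completeness of the rules: a computation is replayed as a derivation.
  \<open>Minimize\<close> climbs through the judgements with tag 9 up to the least zero.\<close>

lemma derivable_eval: "eval A p n = Some y \<Longrightarrow> derivable A (code p, n, y)"
proof (induction p arbitrary: n y)
  case Zero
  then show ?case using derivable_triv by simp
next
  case Succ
  show ?case
    by (rule derivable_infer[OF _ derivable_triv derivable_triv, where r = 2 and L = 0 and k = n]) (use Succ in \<open>simp_all add: infer_def\<close>)
next
  case First
  show ?case
    by (rule derivable_infer[OF _ derivable_triv derivable_triv, where r = 3 and L = 0 and k = n]) (use First in \<open>simp_all add: infer_def\<close>)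
next
  case Second
  show ?case
    by (rule derivable_infer[OF _ derivable_triv derivable_triv, where r = 4 and L = 0 and k = n]) (use Second in \<open>simp_all add: infer_def\<close>)
next
  case Query
  \<comment> \<open>The prefix answers the query at \<open>n\<close> only once its length exceeds
    \<open>n\<close>; all other rules work with prefixes of any length.\<close>
  show ?case
    by (rule derivable_infer[OF _ derivable_triv derivable_triv, where r = 5 and L = "Suc n" and k = n])
      (use Query in \<open>simp_all add: infer_def nth_default_def\<close>)
next
  case (Tuple p q)
  then obtain u v where uv: "eval A p n = Some u" "eval A q n = Some v" "y = prod_encode (u, v)"
    by (auto simp: bind_eq_Some_conv)
  show ?case
    by (rule derivable_infer[OF _ Tuple.IH(1)[OF uv(1)] Tuple.IH(2)[OF uv(2)], where r = 6 and L = 0 and k = 0])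
      (simp_all add: infer_def uv(3))
next
  case (Compose p q)
  then obtain u where u: "eval A q n = Some u" "eval A p u = Some y"
    by (auto simp: bind_eq_Some_conv)
  show ?case
    by (rule derivable_infer[OF _ Compose.IH(2)[OF u(1)] Compose.IH(1)[OF u(2)], where r = 7 and L = 0 and k = 0])
      (simp_all add: infer_def)
next
  case (Recurse p q)
  have "derivable A (code (Recurse p q), prod_encode (a, m), y)"
    if "eval A (Recurse p q) (prod_encode (a, m)) = Some y" for a m y
    using that
  proof (induction m arbitrary: y)
    case 0
    then have "eval A p a = Some y" by simp
    from derivable_infer[OF _ Recurse.IH(1)[OF this] derivable_triv, where r = 8 and L = 0 and k = "code q"]
    show ?case by (simp add: infer_def)
  next
    case (Suc m)
    then obtain v where v: "eval A (Recurse p q) (prod_encode (a, m)) = Some v"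
      "eval A q (prod_encode (a, prod_encode (m, v))) = Some y"
      by (auto simp: bind_eq_Some_conv)
    show ?case
      by (rule derivable_infer[OF _ Suc.IH[OF v(1)] Recurse.IH(2)[OF v(2)], where r = 9 and L = 0 and k = 0]) (auto simp: infer_def)
  qed
  then show ?case using Recurse.prems by (metis prod_decode_inverse surj_pair)
next
  case (Minimize p)
  then have ex: "\<exists>m. eval A p (prod_encode (n, m)) = Some 0 \<and> (\<forall>j<m. eval A p (prod_encode (n, j)) \<noteq> None)"
    and y: "y = (LEAST m. eval A p (prod_encode (n, m)) = Some 0)"
    by (auto split: if_splits)
  have 0: "eval A p (prod_encode (n, y)) = Some 0"
    unfolding y using ex by (metis (mono_tags, lifting) LeastI)
  have S: "\<exists>v. eval A p (prod_encode (n, j)) = Some (Suc v)" if "j < y" for j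
  proof -
    obtain m where m: "eval A p (prod_encode (n, m)) = Some 0" "\<forall>j<m. eval A p (prod_encode (n, j)) \<noteq> None"
      using ex by blast
    have "y \<le> m" unfolding y using m(1) by (rule Least_le)
    then have "eval A p (prod_encode (n, j)) \<noteq> None" using m(2) that by auto
    then obtain v where "eval A p (prod_encode (n, j)) = Some v" by blast
    moreover have "v \<noteq> 0" using that calculation unfolding y by (auto dest: not_less_Least)
    ultimately show ?thesis using not0_implies_Suc by auto
  qed
  have "derivable A (prod_encode (9, code p), prod_encode (n, m), 0)" if "m \<le> y" for m
    using that
  proof (induction m)
    case 0
    show ?case
      by (rule derivable_infer[OF _ derivable_triv derivable_triv, where r = 10 and L = 0 and k = "prod_encode (code p, n)"])
        (auto simp: infer_def)
  next
    case (Suc m)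
    then obtain v where v: "eval A p (prod_encode (n, m)) = Some (Suc v)" using S[of m] by auto
    have "derivable A (prod_encode (9, code p), prod_encode (n, m), 0)" using Suc by simp
    from derivable_infer[OF _ this Minimize.IH[OF v], where r = 11 and L = 0 and k = 0]
    show ?case by (simp add: infer_def)
  qed
  from derivable_infer[OF _ this[of y] Minimize.IH[OF 0], where r = 12 and L = 0 and k = 0] show ?case
    by (simp add: infer_def)
qed

text \<open>Searching all prefixes of \<open>\<sigma>\<close>, and not just \<open>\<sigma>\<close>,
  makes halting monotone in the oracle string, although single facts are not. The length of a prefix
  also bounds the number of inferences.\<close>

definition halts :: "bool list \<Rightarrow> nat \<Rightarrow> nat \<Rightarrow> bool" where
  "halts \<sigma> c n \<longleftrightarrow> (\<exists>l<Suc (length \<sigma>). \<exists>f\<in>set (facts (take l \<sigma>) l). fst f = c \<and> fst (snd f) = n)"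

lemma halts_mono:
  assumes "halts (take l \<sigma>) c n"
  shows "halts \<sigma> c n"
proof -
  obtain k f where "k < Suc (length (take l \<sigma>))" "f \<in> set (facts (take k (take l \<sigma>)) k)" "fst f = c \<and> fst (snd f) = n"
    using assms unfolding halts_def by blast
  moreover have "take k (take l \<sigma>) = take k \<sigma>"
  proof -
    have "k \<le> l" using calculation(1) by simp
    then show ?thesis by (simp add: min_def)
  qed
  ultimately show ?thesis unfolding halts_def by (intro exI[of _ k]) auto
qed

lemma halts_sound:
  assumes "halts (pre A t) (code p) n"
  shows "eval A p n \<noteq> None"
proof -
  obtain l f where f: "l < Suc t" "f \<in> set (facts (pre A l) l)" "fst f = code p" "fst (snd f) = n"
    using assms unfolding halts_def by (auto simp: min_absorb1)
  then show ?thesis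
    using sound_facts[of "pre A l" A f l] by (auto simp: sound_def)
qed

lemma halts_complete:
  assumes "eval A p n \<noteq> None"
  shows "\<exists>L. \<forall>t\<ge>L. halts (pre A t) (code p) n"
proof -
  obtain y where "eval A p n = Some y" using assms by blast
  then obtain i L where L: "\<And>l. l \<ge> L \<Longrightarrow> fact (pre A l) i = (code p, n, y)"
    using derivable_eval unfolding derivable_def by blast
  have "halts (pre A t) (code p) n" if "t \<ge> max L (Suc i)" for t
  proof -
    have "(code p, n, y) = facts (pre A t) t ! i"
      using L[of t] that nth_facts[of i "Suc i" t "pre A t"] by (simp add: fact_def)
    then have "(code p, n, y) \<in> set (facts (pre A t) t)"
      using that by (metis length_facts max.bounded_iff nth_mem Suc_le_eq)
    then show ?thesis unfolding halts_def
      by (intro exI[of _ t]) force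
  qed
  then show ?thesis by blast
qed

lemma computable_halts:
  assumes "computable A s" "computable A c" "computable A n"
  shows "computable A (\<lambda>x. halts (s x) (c x) (n x))"
proof -
  have infer: "computable A (\<lambda>x. infer (s x) (r x) (k x) (f x) (g x))"
    if "computable A s" "computable A r" "computable A k" "computable A f" "computable A g"
    for s r k f and g :: "'b::encodable \<Rightarrow> judgement"
    unfolding infer_def by (intro computable_intros that)
  have facts_rec: "facts \<sigma> t = rec_nat [] (\<lambda>t h. h @ [infer \<sigma> (fst (prod_decode t))
     (snd (prod_decode (snd (prod_decode (snd (prod_decode t))))))
     (nth_default (prod_encode (0, 0), 0, 0) h (fst (prod_decode (snd (prod_decode t)))))
     (nth_default (prod_encode (0, 0), 0, 0) h (fst (prod_decode (snd (prod_decode (snd (prod_decode t)))))))]) t" for \<sigma> t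
    by (induction t) simp_all
  have facts: "computable A (\<lambda>x. facts (s x) (t x))"
    if "computable A s" "computable A t" for s and t :: "'b::encodable \<Rightarrow> nat"
    unfolding facts_rec by (intro computable_intros infer that computable_comp[OF that(1)])
  show ?thesis
    unfolding halts_def
    by (intro computable_intros facts assms computable_comp[OF assms(1)] computable_comp[OF assms(2)] computable_comp[OF assms(3)])
qed

section \<open>The coin measure\<close>

text \<open>Required in \<open>sets_coin\<close> to identify the product sigma-algebra with the
  Borel sets.\<close>

instance bool :: second_countable_topology
proof
  show "\<exists>B :: bool set set. countable B \<and> open = generate_topology B"
    by (intro exI[of _ UNIV]) (auto simp: fun_eq_iff discrete_topology_class.open_discrete intro: generate_topology.Basis)
qed

definition coin :: "cantor measure" where
  "coin = PiM UNIV (\<lambda>_. measure_pmf (bernoulli_pmf (1 / 2)))"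

interpretation coin: product_prob_space "\<lambda>_::nat. measure_pmf (bernoulli_pmf (1 / 2))" UNIV
  rewrites "PiM UNIV (\<lambda>_::nat. measure_pmf (bernoulli_pmf (1 / 2))) = coin"
  by unfold_locales (simp_all add: coin_def)

lemma sets_coin [measurable_cong, simp]: "sets coin = sets borel"
proof -
  have "sets coin = sets (PiM UNIV (\<lambda>_::nat. borel :: bool measure))"
    unfolding coin_def by (rule sets_PiM_cong) (simp_all add: sets_borel_eq_count_space)
  then show ?thesis by (simp only: sets_PiM_equal_borel)
qed

lemma space_coin [simp]: "space coin = UNIV"
  using sets_eq_imp_space_eq[OF sets_coin] by simp

lemma open_prefix: "open {W :: cantor. P (pre W t)}"
proof -
  have "{W :: cantor. P (pre W t)} = (\<Union>s\<in>{s. length s = t \<and> P s}. cylinder s)"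
    by (auto simp: cylinder_pre)
  then show ?thesis by (auto intro: open_cylinder)
qed

lemma measurable_agree: "{W :: cantor. \<forall>k\<in>S. W k = f k} \<in> sets borel"
proof -
  have "{W :: cantor. \<forall>k\<in>S. W k = f k} = (\<Inter>k\<in>S. {W. W k = f k})" by auto
  moreover have "closed {W :: cantor. W k = v}" for k v
    by (intro closed_Collect_eq continuous_on_product_coordinates continuous_on_const)
  ultimately have "closed {W :: cantor. \<forall>k\<in>S. W k = f k}" by auto
  then show ?thesis by (rule borel_closed)
qed

lemma sets_borel_singleton [simp]: "{X :: cantor} \<in> sets borel"
proof -
  have "{X} = {W. \<forall>k\<in>UNIV. W k = X k}" by auto
  then show ?thesis by (simp only: measurable_agree)
qed

lemma measure_coin_coordinates:
  assumes "finite S"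
  shows "measure coin {W. \<forall>k\<in>S. W k = f k} = 1 / 2 ^ card S"
proof -
  have "emeasure coin {W. \<forall>k\<in>S. W k = f k} = (\<Prod>k\<in>S. emeasure (measure_pmf (bernoulli_pmf (1 / 2))) {f k})"
    using coin.emeasure_PiM_Collect[of S "\<lambda>k. {f k}"] assms by simp
  also have "\<dots> = (\<Prod>k\<in>S. ennreal (1 / 2))"
    by (intro prod.cong refl) (auto simp: emeasure_pmf_single pmf_bernoulli_half)
  also have "\<dots> = ennreal ((1 / 2) ^ card S)"
    by (subst prod_constant) (rule ennreal_power, simp)
  finally show ?thesis
    by (simp add: measure_def power_one_over)
qed

lemma measure_coin_cylinder: "measure coin (cylinder s) = 1 / 2 ^ length s"
  using measure_coin_coordinates[of "{..<length s}" "\<lambda>k. s ! k"] by (simp add: cylinder_def Ball_def)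

lemma finite_strings [simp]: "finite {w :: bool list. length w = t \<and> P w}"
  by (rule finite_subset[OF _ finite_lists_length_eq[of "UNIV :: bool set" t]]) auto

lemma card_strings: "card {w :: bool list. length w = t} = 2 ^ t"
  using card_lists_length_eq[of "UNIV :: bool set" t] by (simp add: card_UNIV_bool)

text \<open>Makes cardinalities of sets of strings computable.\<close>

lemma card_strings_filter: "card {w. length w = t \<and> P w} = length (filter P (List.n_lists t [False, True]))"
proof -
  have "{w. length w = t \<and> P w} = set (filter P (List.n_lists t [False, True]))"
    by (auto simp: set_n_lists)
  moreover have "distinct (filter P (List.n_lists t [False, True]))"
    by (intro distinct_filter distinct_n_lists) simp
  ultimately show ?thesis by (simp only: distinct_card)
qed

lemma measure_coin_prefix:
  "measure coin {W. P (pre W t)} = card {w. length w = t \<and> P w} / 2 ^ t"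
proof -
  have "{W. P (pre W t)} = (\<Union>s\<in>{s. length s = t \<and> P s}. cylinder s)"
    by (auto simp: cylinder_pre)
  moreover have "measure coin (\<Union>s\<in>{s. length s = t \<and> P s}. cylinder s) =
      (\<Sum>s\<in>{s. length s = t \<and> P s}. measure coin (cylinder s))"
    by (rule coin.finite_measure_finite_Union) 
      (auto simp: disjoint_family_on_def cylinder_pre intro: borel_open open_cylinder)
  ultimately show ?thesis
    by (simp add: measure_coin_cylinder)
qed

lemma card_strings_take:
  assumes "m \<le> t"
  shows "card {x :: bool list. length x = t \<and> P (take m x)} = 2 ^ (t - m) * card {y. length y = m \<and> P y}"
proof -
  have "card {x :: bool list. length x = t \<and> P (take m x)} =
      card ({y :: bool list. length y = m \<and> P y} \<times> {z :: bool list. length z = t - m})"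
    by (rule bij_betw_same_card[of "\<lambda>x. (take m x, drop m x)"], rule bij_betw_byWitness[where f' = "\<lambda>(y, z). y @ z"])
      (use assms in auto)
  then show ?thesis by (simp add: card_cartesian_product card_strings)
qed

section \<open>A computably approximable random point\<close>

text \<open>The column of a position: \<open>prod_encode (q, j)\<close> is entry \<open>j\<close> of
  column \<open>q\<close>.\<close>

definition cls :: "nat \<Rightarrow> nat" where
  "cls k = fst (prod_decode k)"

definition keep_cols :: "nat set \<Rightarrow> cantor \<Rightarrow> cantor" where
  "keep_cols F A k \<longleftrightarrow> A k \<and> cls k \<in> F"

definition keep_cols_list :: "nat list \<Rightarrow> bool list \<Rightarrow> bool list" where
  "keep_cols_list F w = map (\<lambda>k. nth_default False w k \<and> cls k \<in> set F) [0..<length w]"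

text \<open>Columns in \<open>F\<close> come from \<open>w\<close>, the others from
  \<open>x\<close>. For fixed \<open>w\<close>, counting strings \<open>x\<close> measures the
  section of a set over the columns of \<open>w\<close> in \<open>F\<close>.\<close>

definition mix :: "nat list \<Rightarrow> bool list \<Rightarrow> bool list \<Rightarrow> bool list" where
  "mix F w x = map (\<lambda>k. if cls k \<in> set F then nth_default False w k else nth_default False x k) [0..<length w]"

lemma length_mix [simp]: "length (mix F w x) = length w"
  by (simp add: mix_def)

lemma keep_cols_list_pre: "keep_cols_list F (pre A t) = pre (keep_cols (set F) A) t"
  by (auto simp: keep_cols_list_def pre_def keep_cols_def nth_default_def)

lemma length_keep_cols_list [simp]: "length (keep_cols_list F w) = length w"
  by (simp add: keep_cols_list_def)

lemma keep_cols_list_take: "keep_cols_list F (take t w) = take t (keep_cols_list F w)"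
  by (rule nth_equalityI) (simp_all add: keep_cols_list_def nth_default_def)

lemma keep_cols_list_mix: "keep_cols_list F (mix F w x) = keep_cols_list F w"
  by (auto simp: keep_cols_list_def mix_def nth_default_def)

lemma mix_take: "length x = length w \<Longrightarrow> take t (mix F w x) = mix F (take t w) (take t x)"
  by (rule nth_equalityI) (simp_all add: mix_def nth_default_def)

lemma mix_mix: "mix F (mix F w x) y = mix F w y"
  by (auto simp: mix_def nth_default_def)

lemma mix_involution: "length x = length w \<Longrightarrow> mix F (mix F w x) (mix F x w) = w"
  by (rule nth_equalityI) (simp_all add: mix_def nth_default_def)

text \<open>Requirement \<open>r\<close> codes a program and a list \<open>F\<close> of columns. It is about the test of index
  \<open>r + 2\<close> computed by the program with the columns in \<open>F\<close> as oracle.\<close>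

definition cols :: "nat \<Rightarrow> nat list" where
  "cols r = list_decode (snd (prod_decode r))"

text \<open>Some prefix of \<open>w\<close> is seen to enter the test, with the chosen columns of
  \<open>w\<close> itself as oracle. The level \<open>r + 2\<close> keeps the sum of the bounds
  \<open>1 / 2 ^ (r + 2)\<close> below 1/2.\<close>

definition hit :: "nat \<Rightarrow> bool list \<Rightarrow> bool" where
  "hit r w \<longleftrightarrow> (\<exists>l<Suc (length w).
     halts (keep_cols_list (cols r) w) (fst (prod_decode r)) (prod_encode (r + 2, enc (take l w))))"

text \<open>The second conjunct trims the test: for other contents of the columns in \<open>F\<close> the program need not
  respect the measure bound. It only depends on those columns, which is what makes the Fubini
  argument for \<open>card_bad_le\<close> work.\<close>

definition bad :: "nat \<Rightarrow> bool list \<Rightarrow> bool" where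
  "bad r w \<longleftrightarrow> hit r w \<and>
     card {x. length x = length w \<and> hit r (mix (cols r) w x)} * 2 ^ (r + 2) \<le> 2 ^ length w"

text \<open>Requirement \<open>r\<close> acts only on prefixes longer than \<open>r\<close>, so
  finitely many requirements concern each string and goodness is decidable.\<close>

definition good :: "bool list \<Rightarrow> bool" where
  "good w \<longleftrightarrow> (\<forall>t<Suc (length w). \<forall>r<t. \<not> bad r (take t w))"

lemma hit_mono:
  assumes "hit r (take t w)"
  shows "hit r w"
proof -
  obtain l where l: "l < Suc (length (take t w))"
    "halts (keep_cols_list (cols r) (take t w)) (fst (prod_decode r)) (prod_encode (r + 2, enc (take l (take t w))))"
    using assms unfolding hit_def by blast
  then have "take l (take t w) = take l w" by (simp add: min_absorb1)
  with l show ?thesis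
    unfolding hit_def keep_cols_list_take by (intro exI[of _ l]) (auto dest: halts_mono)
qed

lemma hit_take_mono:
  assumes "hit r (take t w)" "t \<le> t'"
  shows "hit r (take t' w)"
  using hit_mono[of r t "take t' w"] assms by (simp add: min_absorb1)

text \<open>By Fubini. Fix the columns in \<open>cols r\<close> as those of \<open>w\<close> and let
  the others vary. The trimming condition depends on the fixed columns alone and hits persist under
  extension, so every bad string of this section is a hit at the greatest length \<open>M\<close>
  where the condition holds; there the condition bounds the number of hits. Summing over
  \<open>w\<close> gives the claim.\<close>

lemma card_bad_le:
  "card {w. length w = t \<and> (\<exists>m\<le>t. bad r (take m w))} * 2 ^ (r + 2) \<le> 2 ^ t"
proof -
  let ?S = "{w :: bool list. length w = t}"
  let ?F = "cols r"
  define B where "B = {w. length w = t \<and> (\<exists>m\<le>t. bad r (take m w))}"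
  have section_le: "card {x\<in>?S. mix ?F w x \<in> B} * 2 ^ (r + 2) \<le> 2 ^ t" if w: "w \<in> ?S" for w
  proof -
    \<comment> \<open>The lengths at which the section over \<open>w\<close> satisfies the trimming
      condition of \<open>bad\<close>.\<close>
    define T where "T = {m. m \<le> t \<and> card {y. length y = m \<and> hit r (mix ?F (take m w) y)} * 2 ^ (r + 2) \<le> 2 ^ m}"
    have T: "\<exists>m\<in>T. hit r (mix ?F (take m w) (take m x))" if x: "x \<in> ?S" "mix ?F w x \<in> B" for x
    proof -
      obtain m where m: "m \<le> t" "bad r (take m (mix ?F w x))"
        using \<open>mix ?F w x \<in> B\<close> unfolding B_def by blast
      then have "bad r (mix ?F (take m w) (take m x))"
        using x w by (simp add: mix_take)
      then show ?thesis
        using m(1) w unfolding bad_def T_def mix_mix by (auto simp: min_absorb1)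
    qed
    show ?thesis
    proof (cases "T = {}")
      case True
      then have "{x\<in>?S. mix ?F w x \<in> B} = {}" using T by blast
      then show ?thesis by (simp only: card.empty)
    next
      case False
      have "finite T" unfolding T_def by simp
      define M where "M = Max T"
      have M: "M \<in> T" unfolding M_def using \<open>finite T\<close> False by (rule Max_in)
      then have "M \<le> t" unfolding T_def by blast
      have "hit r (mix ?F (take M w) (take M x))" if x: "x \<in> ?S" "mix ?F w x \<in> B" for x
      proof -
        obtain m where "m \<in> T" "hit r (mix ?F (take m w) (take m x))"
          using T[OF x] by blast
        moreover have "m \<le> M" unfolding M_def using \<open>finite T\<close> \<open>m \<in> T\<close> by (rule Max_ge)
        ultimately show ?thesis
          using hit_take_mono[of r m "mix ?F w x" M] x w by (simp add: mix_take)
      qed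
      then have "card {x\<in>?S. mix ?F w x \<in> B} \<le> card {x. length x = t \<and> hit r (mix ?F (take M w) (take M x))}"
        by (intro card_mono) auto
      also have "\<dots> = 2 ^ (t - M) * card {y. length y = M \<and> hit r (mix ?F (take M w) y)}"
        by (rule card_strings_take[OF \<open>M \<le> t\<close>])
      finally have "card {x\<in>?S. mix ?F w x \<in> B} * 2 ^ (r + 2) \<le>
          2 ^ (t - M) * card {y. length y = M \<and> hit r (mix ?F (take M w) y)} * 2 ^ (r + 2)"
        by (rule mult_le_mono1)
      also have "\<dots> = 2 ^ (t - M) * (card {y. length y = M \<and> hit r (mix ?F (take M w) y)} * 2 ^ (r + 2))"
        by (rule mult.assoc)
      also have "\<dots> \<le> 2 ^ (t - M) * 2 ^ M"
        using M unfolding T_def by (intro mult_le_mono2) blast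
      also have "\<dots> = 2 ^ t"
        using \<open>M \<le> t\<close> by (simp flip: power_add)
      finally show ?thesis .
    qed
  qed
  have fin: "finite ?S" using finite_strings[of t "\<lambda>_. True"] by simp
  \<comment> \<open>\<open>swap\<close> exchanges the parts of two strings outside the columns in
    \<open>?F\<close>. This involution turns the count of \<open>B \<times> ?S\<close> into a sum of
    section counts.\<close>
  define swap where "swap p = (mix ?F (fst p) (snd p), mix ?F (snd p) (fst p))" for p
  have swap: "swap (swap p) = p" "swap p \<in> ?S \<times> ?S" if "p \<in> ?S \<times> ?S" for p
    using that by (auto simp: swap_def mix_involution prod_eq_iff)
  have "B \<subseteq> ?S" unfolding B_def by blast
  have "bij_betw swap (B \<times> ?S) {p \<in> ?S \<times> ?S. fst (swap p) \<in> B}"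
  proof (rule bij_betw_byWitness[where f' = swap])
    show "\<forall>p\<in>B \<times> ?S. swap (swap p) = p"
      using swap(1) \<open>B \<subseteq> ?S\<close> by blast
    show "\<forall>p\<in>{p \<in> ?S \<times> ?S. fst (swap p) \<in> B}. swap (swap p) = p"
      using swap(1) by blast
    show "swap ` (B \<times> ?S) \<subseteq> {p \<in> ?S \<times> ?S. fst (swap p) \<in> B}"
    proof (rule image_subsetI)
      fix p assume p: "p \<in> B \<times> ?S"
      then have "p \<in> ?S \<times> ?S" using \<open>B \<subseteq> ?S\<close> by blast
      from swap[OF this] p show "swap p \<in> {p \<in> ?S \<times> ?S. fst (swap p) \<in> B}" by auto
    qed
    show "swap ` {p \<in> ?S \<times> ?S. fst (swap p) \<in> B} \<subseteq> B \<times> ?S"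
    proof (rule image_subsetI)
      fix p assume "p \<in> {p \<in> ?S \<times> ?S. fst (swap p) \<in> B}"
      then show "swap p \<in> B \<times> ?S" using swap(2)[of p] by (simp add: mem_Times_iff)
    qed
  qed
  from bij_betw_same_card[OF this]
  have "card (B \<times> ?S) = card {p \<in> ?S \<times> ?S. mix ?F (fst p) (snd p) \<in> B}"
    by (simp add: swap_def)
  also have "{p \<in> ?S \<times> ?S. mix ?F (fst p) (snd p) \<in> B} = (SIGMA w:?S. {x\<in>?S. mix ?F w x \<in> B})"
    by auto
  also have "card \<dots> = (\<Sum>w\<in>?S. card {x\<in>?S. mix ?F w x \<in> B})"
    using fin by (intro card_SigmaI) auto
  finally have "card B * 2 ^ t * 2 ^ (r + 2) = (\<Sum>w\<in>?S. card {x\<in>?S. mix ?F w x \<in> B} * 2 ^ (r + 2))"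
    by (simp only: card_cartesian_product card_strings sum_distrib_right)
  also have "\<dots> \<le> (\<Sum>w\<in>?S. 2 ^ t)"
    using section_le by (rule sum_mono)
  also have "\<dots> = 2 ^ t * 2 ^ t"
    by (simp add: card_strings)
  finally have "2 ^ t * (card B * 2 ^ (r + 2)) \<le> 2 ^ t * 2 ^ t"
    by (simp only: mult_ac)
  then show ?thesis
    unfolding B_def by simp
qed

text \<open>Union bound: the requirements below \<open>t\<close> remove a fraction of less than 1/2
  of the strings.\<close>

lemma ex_good: "\<exists>w. length w = t \<and> good w"
proof (rule ccontr)
  let ?B = "\<lambda>r. {w. length w = t \<and> (\<exists>m\<le>t. bad r (take m w))}"
  assume "\<not> ?thesis"
  then have "{w. length w = t} \<subseteq> (\<Union>r<t. ?B r)"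
    unfolding good_def by (fastforce simp: less_Suc_eq_le)
  then have "2 ^ t \<le> card (\<Union>r<t. ?B r)"
    using card_mono[of "\<Union>r<t. ?B r" "{w. length w = t}"] by (simp add: card_strings)
  also have "\<dots> \<le> (\<Sum>r<t. card (?B r))"
    by (rule card_UN_le) simp
  finally have "real (2 ^ t) \<le> real (\<Sum>r<t. card (?B r))"
    by (rule of_nat_mono)
  then have "2 ^ t \<le> (\<Sum>r<t. real (card (?B r)))"
    by (simp only: of_nat_power of_nat_numeral of_nat_sum)
  also have "\<dots> \<le> (\<Sum>r<t. 2 ^ t * (1 / 2 ^ (r + 2)))"
  proof (rule sum_mono)
    fix r
    have "real (card (?B r) * 2 ^ (r + 2)) \<le> real (2 ^ t)"
      using card_bad_le[of t r] by (rule of_nat_mono)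
    then show "real (card (?B r)) \<le> 2 ^ t * (1 / 2 ^ (r + 2))"
      by (simp add: field_simps)
  qed
  also have "\<dots> = 2 ^ t * (\<Sum>r<t. 1 / 2 ^ (r + 2))"
    by (simp only: sum_distrib_left)
  also have "(\<Sum>r<t. 1 / 2 ^ (r + 2)) = (1 / 2 - 1 / 2 ^ (t + 1) :: real)"
    by (induction t) (simp_all add: field_simps)
  also have "2 ^ t * (1 / 2 - 1 / 2 ^ (t + 1)) < (2 ^ t :: real)"
    by (simp add: field_simps add_pos_pos)
  finally show False by simp
qed

lemma good_take: "good w \<Longrightarrow> good (take t w)"
  unfolding good_def by (auto simp: min_def split: if_splits)

section \<open>The leftmost path and its approximations\<close>

definition extendible :: "nat \<Rightarrow> bool list \<Rightarrow> bool" where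
  "extendible t u \<longleftrightarrow> (\<exists>w\<in>set (List.n_lists t [False, True]). good w \<and> take (length u) w = u)"

lemma extendible_iff: "extendible t u \<longleftrightarrow> (\<exists>w. length w = t \<and> good w \<and> take (length u) w = u)"
  by (auto simp: extendible_def set_n_lists)

lemma extendible_antimono:
  assumes "extendible t' u" "length u \<le> t" "t \<le> t'"
  shows "extendible t u"
proof -
  obtain w where "length w = t'" "good w" "take (length u) w = u"
    using assms(1) unfolding extendible_iff by blast
  then show ?thesis
    unfolding extendible_iff using assms(2,3)
    by (intro exI[of _ "take t w"]) (auto simp: good_take min_absorb1)
qed

primrec leftmost :: "(bool list \<Rightarrow> bool) \<Rightarrow> nat \<Rightarrow> bool list" where
  "leftmost E 0 = []"
| "leftmost E (Suc k) = leftmost E k @ [\<not> E (leftmost E k @ [False])]"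

text \<open>The leftmost good string of length \<open>t\<close>, followed by \<open>True\<close>
  forever, because no string of length \<open>t\<close> extends a longer one.\<close>

definition approx :: "nat \<Rightarrow> cantor" where
  "approx t k \<longleftrightarrow> \<not> extendible t (leftmost (extendible t) k @ [False])"

definition ever_extendible :: "bool list \<Rightarrow> bool" where
  "ever_extendible u \<longleftrightarrow> (\<forall>t\<ge>length u. extendible t u)"

text \<open>The leftmost infinite path through the tree of good strings.\<close>

definition rand :: cantor where
  "rand k \<longleftrightarrow> \<not> ever_extendible (leftmost ever_extendible k @ [False])"

lemma length_leftmost [simp]: "length (leftmost E k) = k"
  by (induction k) simp_all

lemma leftmost_approx: "leftmost (extendible t) k = pre (approx t) k"
  by (induction k) (simp_all add: approx_def pre_def)

lemma leftmost_rand: "leftmost ever_extendible k = pre rand k"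
  by (induction k) (simp_all add: rand_def pre_def)

text \<open>Koenig's lemma: if the extension by \<open>False\<close> dies at some length, every
  longer good string through the prefix continues with \<open>True\<close>.\<close>

lemma ever_extendible_pre_rand: "ever_extendible (pre rand k)"
proof (induction k)
  case 0
  show ?case using ex_good by (auto simp: ever_extendible_def extendible_iff pre_def)
next
  case (Suc k)
  let ?u = "pre rand k"
  have pre_Suc: "pre rand (Suc k) = ?u @ [rand k]" by (simp add: pre_def)
  show ?case
  proof (cases "ever_extendible (?u @ [False])")
    case True
    moreover have "\<not> rand k" using True by (simp add: rand_def leftmost_rand)
    ultimately show ?thesis by (simp add: pre_Suc)
  next
    case False
    then have "rand k" by (simp add: rand_def leftmost_rand)
    obtain t' where t': "t' \<ge> Suc k" "\<not> extendible t' (?u @ [False])"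
      using False unfolding ever_extendible_def by auto
    have "extendible t (?u @ [True])" if "t \<ge> Suc k" for t
    proof -
      have "extendible (max t t') ?u"
        using Suc that unfolding ever_extendible_def by auto
      then obtain w where w: "length w = max t t'" "good w" "take k w = ?u"
        unfolding extendible_iff by auto
      have *: "take (Suc k) w = ?u @ [w ! k]"
        using w that by (simp add: take_Suc_conv_app_nth)
      have "w ! k"
      proof (rule ccontr)
        assume "\<not> w ! k"
        then have "extendible (max t t') (?u @ [False])"
          unfolding extendible_iff using w(1,2) * by (intro exI[of _ w]) auto
        then show False
          using t' extendible_antimono by (metis length_append_singleton length_pre max.cobounded2)
      qed
      then have "extendible (max t t') (?u @ [True])"
        unfolding extendible_iff using w(1,2) * by (intro exI[of _ w]) auto
      then show ?thesis
        by (rule extendible_antimono) (use that in auto)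
    qed
    then show ?thesis
      unfolding pre_Suc ever_extendible_def using \<open>rand k\<close> by simp
  qed
qed

lemma good_rand: "good (pre rand k)"
proof -
  obtain w where "good w" "take k w = pre rand k"
    using ever_extendible_pre_rand[of k] unfolding ever_extendible_def extendible_iff by auto
  then show ?thesis using good_take by metis
qed

text \<open>Extendibility of a fixed string can only be lost as \<open>t\<close> grows, so each
  choice of the leftmost search settles after the earlier ones have.\<close>

lemma approx_pre_tendsto_rand: "\<exists>T. \<forall>t\<ge>T. pre (approx t) k = pre rand k"
proof (induction k)
  case 0
  show ?case by (simp add: pre_def)
next
  case (Suc k)
  let ?u = "pre rand k"
  obtain T where T: "\<And>t. t \<ge> T \<Longrightarrow> pre (approx t) k = ?u" using Suc by blast
  have "\<exists>T'. \<forall>t\<ge>T'. extendible t (?u @ [False]) = ever_extendible (?u @ [False])"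
  proof (cases "ever_extendible (?u @ [False])")
    case True
    then show ?thesis unfolding ever_extendible_def by (intro exI[of _ "Suc k"]) auto
  next
    case False
    then obtain t' where "t' \<ge> Suc k" "\<not> extendible t' (?u @ [False])"
      unfolding ever_extendible_def by auto
    then show ?thesis
      using False extendible_antimono[of _ "?u @ [False]" t'] by (intro exI[of _ t']) auto
  qed
  then obtain T' where T': "\<And>t. t \<ge> T' \<Longrightarrow> extendible t (?u @ [False]) = ever_extendible (?u @ [False])"
    by blast
  have "pre (approx t) (Suc k) = pre rand (Suc k)" if "t \<ge> max T T'" for t
  proof -
    have "approx t k = rand k"
      using that T T' by (simp add: approx_def rand_def leftmost_approx leftmost_rand)
    then show ?thesis using T that by (simp add: pre_def)
  qed
  then show ?case by blast
qed

lemma approx_tendsto_rand: "\<exists>T. \<forall>t\<ge>T. \<forall>j<k. approx t j = rand j"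
  using approx_pre_tendsto_rand[of k] by (simp add: pre_eq_iff)

lemma computable_cls:
  assumes "computable A f"
  shows "computable A (\<lambda>x. cls (f x))"
  unfolding cls_def by (intro computable_intros assms)

text \<open>All searches involved are bounded, and the cardinality in \<open>bad\<close> is the
  length of a filtered list.\<close>

lemma computable_approx:
  assumes "computable A f" "computable A g"
  shows "computable A (\<lambda>x. approx (f x) (g x))"
proof -
  have keep_cols: "computable A (\<lambda>x. keep_cols_list (F x) (w x))"
    if "computable A F" "computable A w" for F and w :: "'b::encodable \<Rightarrow> bool list"
    unfolding keep_cols_list_def
    by (intro computable_intros computable_cls that computable_comp[OF that(1)] computable_comp[OF that(2)])
  have mix: "computable A (\<lambda>x. mix (F x) (w x) (y x))"
    if "computable A F" "computable A w" "computable A y" for F w and y :: "'b::encodable \<Rightarrow> bool list"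
    unfolding mix_def
    by (intro computable_intros computable_cls that computable_comp[OF that(1)] computable_comp[OF that(2)]
        computable_comp[OF that(3)])
  have cols: "computable A (\<lambda>x. cols (r x))" if "computable A r" for r :: "'b::encodable \<Rightarrow> nat"
    unfolding cols_def by (intro computable_intros that)
  have hit: "computable A (\<lambda>x. hit (r x) (w x))"
    if "computable A r" "computable A w" for r and w :: "'b::encodable \<Rightarrow> bool list"
    unfolding hit_def
    by (intro computable_intros computable_halts keep_cols cols that computable_comp[OF that(1)] computable_comp[OF that(2)])
  have bad: "computable A (\<lambda>x. bad (r x) (w x))"
    if "computable A r" "computable A w" for r and w :: "'b::encodable \<Rightarrow> bool list"
    unfolding bad_def card_strings_filter
    by (intro computable_intros hit mix cols that computable_comp[OF that(1)] computable_comp[OF that(2)])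
  have good: "computable A (\<lambda>x. good (w x))" if "computable A w" for w :: "'b::encodable \<Rightarrow> bool list"
    unfolding good_def by (intro computable_intros bad that computable_comp[OF that])
  have ext: "computable A (\<lambda>x. extendible (t x) (u x))"
    if "computable A t" "computable A u" for t and u :: "'b::encodable \<Rightarrow> bool list"
    unfolding extendible_def
    by (intro computable_intros good that computable_comp[OF that(1)] computable_comp[OF that(2)])
  have leftmost_rec: "leftmost E k = rec_nat [] (\<lambda>_ u. u @ [\<not> E (u @ [False])]) k" for E k
    by (induction k) simp_all
  have left: "computable A (\<lambda>x. leftmost (extendible (t x)) (k x))"
    if "computable A t" "computable A k" for t and k :: "'b::encodable \<Rightarrow> nat"
    unfolding leftmost_rec by (intro computable_intros ext that computable_comp[OF that(1)])
  show ?thesis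
    unfolding approx_def by (intro computable_intros ext left assms)
qed

text \<open>A form of van Lambalgen's theorem: by \<open>inv\<close> the test does not look at the
  columns in \<open>F\<close>, which serve as its oracle. Were \<open>rand\<close> caught, the
  program and \<open>F\<close> would form a requirement \<open>r\<close> hit by a long prefix of
  \<open>rand\<close>. The measure bound holds for the oracle taken from \<open>rand\<close>, so
  trimming does not remove the hit, and the prefix is bad, against \<open>good_rand\<close>.\<close>

lemma rand_passes_test:
  assumes test: "martin_loef_test coin (keep_cols F rand) V" and "finite F"
    and inv: "\<And>i W W'. W \<in> V i \<Longrightarrow> (\<And>k. cls k \<notin> F \<Longrightarrow> W k = W' k) \<Longrightarrow> W' \<in> V i"
  shows "\<exists>i. rand \<notin> V i"
proof (rule ccontr)
  assume "\<not> ?thesis"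
  then have rand_V: "rand \<in> V i" for i by blast
  obtain p where V: "\<And>i. V i = (\<Union>s\<in>{s. eval (keep_cols F rand) p (prod_encode (i, string_code s)) \<noteq> None}. cylinder s)"
    and V_le: "\<And>i. measure coin (V i) \<le> 1 / 2 ^ i"
    using test unfolding martin_loef_test_def uniformly_Sigma1_def by blast
  obtain Fs where Fs: "set Fs = F" using \<open>finite F\<close> finite_list by blast
  define r where "r = prod_encode (code p, list_encode Fs)"
  have cols_r: "cols r = Fs" by (simp add: cols_def r_def)
  have fst_r: "fst (prod_decode r) = code p" by (simp add: r_def)
  obtain s where s: "eval (keep_cols F rand) p (prod_encode (r + 2, string_code s)) \<noteq> None" "pre rand (length s) = s"
    using rand_V[of "r + 2"] unfolding V by (auto simp: cylinder_pre)
  obtain L where L: "\<And>t. t \<ge> L \<Longrightarrow> halts (pre (keep_cols F rand) t) (code p) (prod_encode (r + 2, string_code s))"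
    using halts_complete[OF s(1)] by blast
  \<comment> \<open>Long enough to see the enumeration of \<open>s\<close>, to contain
    \<open>s\<close>, and to exceed \<open>r\<close> so that \<open>good\<close> takes requirement
    \<open>r\<close> into account.\<close>
  define t where "t = max L (max (length s) (Suc r))"
  have "hit r (pre rand t)"
    unfolding hit_def cols_r fst_r keep_cols_list_pre Fs
    using L[of t] s(2) by (intro exI[of _ "length s"]) (auto simp: t_def enc_string min_absorb1)
  moreover have "real (card {x. length x = t \<and> hit r (mix Fs (pre rand t) x)} * 2 ^ (r + 2)) \<le> real (2 ^ t)"
  proof -
    have sub: "{W. hit r (mix Fs (pre rand t) (pre W t))} \<subseteq> V (r + 2)"
    proof
      fix W assume "W \<in> {W. hit r (mix Fs (pre rand t) (pre W t))}"
      then have W: "hit r (mix Fs (pre rand t) (pre W t))" by simp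
      \<comment> \<open>\<open>Y\<close> takes the columns in \<open>F\<close> from
        \<open>rand\<close>. The hit puts \<open>Y\<close> into the test, and \<open>inv\<close>
        transfers this to \<open>W\<close>.\<close>
      define Y where "Y k = (if cls k \<in> F then rand k else W k)" for k
      have Y: "mix Fs (pre rand t) (pre W t) = pre Y t"
        by (auto simp: mix_def nth_default_def pre_def Y_def Fs)
      obtain l where l: "l \<le> t" "halts (pre (keep_cols F rand) t) (code p) (prod_encode (r + 2, enc (pre Y l)))"
        using W unfolding hit_def cols_r keep_cols_list_mix fst_r keep_cols_list_pre Fs
        by (auto simp: Y less_Suc_eq_le min_absorb1)
      from halts_sound[OF l(2)] have "Y \<in> V (r + 2)"
        unfolding V by (auto simp: enc_string cylinder_pre intro!: exI[of _ "pre Y l"])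
      then show "W \<in> V (r + 2)" by (rule inv) (simp add: Y_def)
    qed
    have "open (V (r + 2))" unfolding V by (auto intro: open_cylinder)
    then have "measure coin {W. hit r (mix Fs (pre rand t) (pre W t))} \<le> measure coin (V (r + 2))"
      by (intro coin.finite_measure_mono sub) (simp add: borel_open)
    also note V_le
    finally have "card {x. length x = t \<and> hit r (mix Fs (pre rand t) x)} / 2 ^ t \<le> (1 / 2 ^ (r + 2) :: real)"
      unfolding measure_coin_prefix[of "\<lambda>u. hit r (mix Fs (pre rand t) u)" t] .
    then show ?thesis by (simp add: field_simps)
  qed
  ultimately have "bad r (pre rand t)"
    unfolding bad_def cols_r length_pre of_nat_le_iff by blast
  moreover have "r < t" by (simp add: t_def)
  ultimately show False
    using good_rand[of t] unfolding good_def by (metis length_pre lessI order_refl take_all)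
qed

section \<open>The trivial measure of a family of column sets\<close>

definition enumerates :: "cantor \<Rightarrow> program \<Rightarrow> nat \<Rightarrow> bool list \<Rightarrow> bool" where
  "enumerates A p i s \<longleftrightarrow> eval A p (enc (i, s)) \<noteq> None"

definition Sigma1 :: "cantor \<Rightarrow> program \<Rightarrow> nat \<Rightarrow> cantor set" where
  "Sigma1 A p i = (\<Union>s\<in>{s. enumerates A p i s}. cylinder s)"

lemma uniformly_Sigma1_iff: "uniformly_Sigma1 A U \<longleftrightarrow> (\<exists>p. U = Sigma1 A p)"
  by (auto simp: uniformly_Sigma1_def Sigma1_def enumerates_def enc_string fun_eq_iff)

lemma mem_Sigma1: "X \<in> Sigma1 A p i \<longleftrightarrow> (\<exists>l. enumerates A p i (pre X l))"
proof
  assume "X \<in> Sigma1 A p i"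
  then obtain s where "enumerates A p i s" "pre X (length s) = s"
    by (auto simp: Sigma1_def cylinder_pre)
  then show "\<exists>l. enumerates A p i (pre X l)" by metis
next
  assume "\<exists>l. enumerates A p i (pre X l)"
  then obtain l where "enumerates A p i (pre X l)" by blast
  then show "X \<in> Sigma1 A p i"
    unfolding Sigma1_def by (intro UN_I[of "pre X l"]) (simp_all add: cylinder_pre)
qed

lemma open_Sigma1: "open (Sigma1 A p i)"
  unfolding Sigma1_def by (auto intro: open_cylinder)

lemma not_MLR_iff:
  "X \<notin> MLR \<mu> A \<longleftrightarrow> (\<exists>p. (\<forall>i. X \<in> Sigma1 A p i) \<and> (\<forall>i. measure \<mu> (Sigma1 A p i) \<le> 1 / 2 ^ i))"
  unfolding MLR_def martin_loef_test_def uniformly_Sigma1_iff by blast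

definition ones :: "bool list \<Rightarrow> nat" where
  "ones u = length (filter (\<lambda>x. x) u)"

lemma ones_simps [simp]: "ones [] = 0" "ones (u @ v) = ones u + ones v" "ones [x] = of_bool x"
  by (auto simp: ones_def)

lemma ones_le_length: "ones u \<le> length u"
  by (simp add: ones_def)

lemma pre_Suc: "pre X (Suc t) = pre X t @ [X t]"
  and pre_0 [simp]: "pre X 0 = []"
  by (simp_all add: pre_def)

lemma ones_pre_mono: "s \<le> t \<Longrightarrow> ones (pre X s) \<le> ones (pre X t)"
  by (induction t) (auto simp: pre_Suc le_Suc_eq)

text \<open>Reads off the point from the times at which its approximation was confirmed.\<close>

primrec decode :: "cantor \<Rightarrow> nat \<Rightarrow> bool list" where
  "decode Y 0 = []"
| "decode Y (Suc s) = (if Y s then decode Y s @ [approx s (length (decode Y s))] else decode Y s)"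

lemma length_decode: "length (decode Y s) = ones (pre Y s)"
  by (induction s) (auto simp: pre_Suc)

lemma decode_cong: "(\<And>k. k < s \<Longrightarrow> Y k = Y' k) \<Longrightarrow> decode Y s = decode Y' s"
  by (induction s) auto

lemma computable_decode:
  assumes "computable A u" "computable A n"
  shows "computable A (\<lambda>x. decode (nth_default False (u x)) (n x))"
proof -
  have "decode Y s = rec_nat [] (\<lambda>s d. if Y s then d @ [approx s (length d)] else d) s" for Y s
    by (induction s) simp_all
  then show ?thesis
    by simp (intro computable_intros computable_approx assms computable_comp[OF assms(1)])
qed

text \<open>\<open>tab\<close> lists the pairs of an index and a column assigned to it; as a finite
  list it can be consulted by a program. \<open>K\<close> is the length of the indices.\<close>

locale coding =
  fixes K :: nat and tab :: "(bool list \<times> nat) list"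
begin

definition Q :: "bool list \<Rightarrow> nat set" where
  "Q b = {q. (b, q) \<in> set tab}"

text \<open>Bit \<open>s\<close> of \<open>Phi b W\<close> tells whether stage \<open>s\<close> confirms one more digit; \<open>m\<close> digits are confirmed
  before. Digits outside the columns in \<open>Q b\<close> are confirmed immediately.\<close>

definition confirm :: "bool list \<Rightarrow> cantor \<Rightarrow> nat \<Rightarrow> nat \<Rightarrow> bool" where
  "confirm b W s m \<longleftrightarrow> (\<forall>k<Suc m. (b, cls k) \<in> set tab \<longrightarrow> W k = approx s k)"

primrec phi :: "bool list \<Rightarrow> cantor \<Rightarrow> nat \<Rightarrow> bool list" where
  "phi b W 0 = []"
| "phi b W (Suc s) = phi b W s @ [confirm b W s (ones (phi b W s))]"

definition Phi :: "bool list \<Rightarrow> cantor \<Rightarrow> cantor" where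
  "Phi b W s = confirm b W s (ones (phi b W s))"

definition point :: "bool list \<Rightarrow> cantor \<Rightarrow> cantor" where
  "point b W k = (if k < length b then b ! k else Phi b W (k - length b))"

definition indices :: "bool list set" where
  "indices = {b. length b = K}"

text \<open>All strings of length \<open>K\<close> are indices, each of weight
  \<open>1 / 2 ^ K\<close>, which keeps cylinder measures dyadic. An index without columns
  contributes a single atom, as each stage then confirms.\<close>

definition mu :: "cantor measure" where
  "mu = distr (measure_pmf (pmf_of_set indices) \<Otimes>\<^sub>M coin) borel (\<lambda>(b, W). point b W)"

lemma finite_indices: "finite indices" and card_indices: "card indices = 2 ^ K"
  using finite_strings[of K "\<lambda>_. True"] card_strings[of K] by (simp_all add: indices_def)

lemma phi_eq_pre: "phi b W s = pre (Phi b W) s"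
  by (induction s) (simp_all add: pre_Suc Phi_def)

lemma length_phi [simp]: "length (phi b W s) = s"
  by (simp add: phi_eq_pre)

lemma pre_point: "pre (point b W) (length b + s) = b @ phi b W s"
  by (rule nth_equalityI) (auto simp: point_def phi_eq_pre nth_append)

lemma pre_point_short: "l \<le> length b \<Longrightarrow> pre (point b W) l = take l b"
  by (rule nth_equalityI) (auto simp: point_def)

text \<open>A stage consults \<open>W\<close> only up to the number of digits confirmed before
  it.\<close>

lemma phi_cong_ones:
  assumes "\<And>s' k. s' < s \<Longrightarrow> k \<le> ones (phi b W s') \<Longrightarrow> cls k \<in> Q b \<Longrightarrow> W k = W' k"
  shows "phi b W s = phi b W' s"
  using assms
proof (induction s)
  case (Suc s)
  have "phi b W s = phi b W' s"
    using Suc.prems by (intro Suc.IH) (meson less_SucI)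
  moreover have "W k = W' k" if "k \<le> ones (phi b W s)" "cls k \<in> Q b" for k
    using Suc.prems[of s k] that by simp
  ultimately show ?case by (auto simp: confirm_def Q_def less_Suc_eq_le)
qed simp

text \<open>As long as at most \<open>m\<close> digits are confirmed, the prefix of length
  \<open>m + 1\<close> decides the outcome. This is where the atoms come from.\<close>

lemma phi_cong_le:
  assumes "ones (phi b W s) \<le> m" "\<And>k. k \<le> m \<Longrightarrow> cls k \<in> Q b \<Longrightarrow> W k = W' k"
  shows "phi b W s = phi b W' s"
proof (rule phi_cong_ones)
  fix s' k assume "s' < s" "k \<le> ones (phi b W s')" "cls k \<in> Q b"
  moreover have "ones (phi b W s') \<le> ones (phi b W s)"
    unfolding phi_eq_pre using \<open>s' < s\<close> by (intro ones_pre_mono) simp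
  ultimately show "W k = W' k" using assms by simp
qed

lemma phi_cong:
  assumes "\<And>k. k < s \<Longrightarrow> cls k \<in> Q b \<Longrightarrow> W k = W' k"
  shows "phi b W s = phi b W' s"
proof (rule phi_cong_ones)
  fix s' k assume "s' < s" "k \<le> ones (phi b W s')" "cls k \<in> Q b"
  then show "W k = W' k" using assms ones_le_length[of "phi b W s'"] by simp
qed

lemma phi_nth_default_pre: "phi b (nth_default False (pre W l)) l = phi b W l"
  by (rule phi_cong) (simp add: nth_default_def)

text \<open>\<open>decode\<close> appends digit \<open>k\<close> at the stage that confirms it, when
  \<open>approx\<close> agrees with \<open>W\<close> at \<open>k\<close>.\<close>

lemma decode_Phi:
  assumes "k < ones (phi b W s)" "cls k \<in> Q b"
  shows "decode (Phi b W) s ! k = W k"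
  using assms
proof (induction s)
  case (Suc s)
  have len: "length (decode (Phi b W) s) = ones (phi b W s)"
    by (simp add: length_decode phi_eq_pre)
  show ?case
  proof (cases "k < ones (phi b W s)")
    case True
    then show ?thesis using Suc len by (simp add: nth_append)
  next
    case False
    then have "Phi b W s" "k = ones (phi b W s)"
      using Suc.prems(1) by (auto simp: Phi_def of_bool_def split: if_splits)
    moreover have "W k = approx s k"
      using \<open>Phi b W s\<close> Suc.prems(2) calculation(2) by (simp add: Phi_def confirm_def Q_def)
    ultimately show ?thesis by (simp add: nth_append len)
  qed
qed simp

text \<open>Once \<open>approx\<close> agrees with \<open>rand\<close> on the digits concerned, a
  stage confirms. The count rises by at most 1 per stage, so it takes every value.\<close>

lemma ones_phi_rand: "\<exists>s. ones (phi b rand s) = m"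
proof (induction m)
  case 0
  show ?case by (rule exI[of _ 0]) simp
next
  case (Suc m)
  then obtain s where s: "ones (phi b rand s) = m" by blast
  obtain T where T: "\<And>t j. t \<ge> T \<Longrightarrow> j < Suc m \<Longrightarrow> approx t j = rand j"
    using approx_tendsto_rand[of "Suc m"] by blast
  show ?case
  proof (rule ccontr)
    assume no: "\<not> ?thesis"
    have "ones (phi b rand (s + t)) = m" for t
    proof (induction t)
      case (Suc t)
      have "ones (phi b rand (s + Suc t)) \<noteq> Suc m" using no by blast
      then show ?case using Suc by (auto split: if_splits)
    qed (simp add: s)
    then have "ones (phi b rand (s + T)) = m" "ones (phi b rand (Suc (s + T))) = m"
      by (metis add_Suc_right)+
    then have "\<not> confirm b rand (s + T) m" by auto
    then show False using T[of "s + T"] by (auto simp: confirm_def)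
  qed
qed

text \<open>Bit \<open>k\<close> of the image depends only on the first \<open>k + 1\<close> digits
  of \<open>W\<close>.\<close>

lemma point_measurable [measurable]: "point b \<in> borel_measurable coin"
proof (rule measurable_coordinatewise_then_product)
  fix k
  have eq: "point b W k = point b (nth_default False (pre W (Suc k))) k" for W
  proof -
    have "Phi b W j = Phi b (nth_default False (pre W (Suc k))) j" if "j \<le> k" for j
    proof -
      have "phi b W (Suc k) = phi b (nth_default False (pre W (Suc k))) (Suc k)"
        by (simp only: phi_nth_default_pre)
      then have "phi b W (Suc k) ! j = phi b (nth_default False (pre W (Suc k))) (Suc k) ! j"
        by (rule arg_cong)
      then show ?thesis using that unfolding phi_eq_pre by simp
    qed
    then show ?thesis by (simp add: point_def)
  qed
  have "(\<lambda>W. point b W k) -` S \<in> sets borel" for S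
  proof -
    have "(\<lambda>W. point b W k) -` S = {W. point b (nth_default False (pre W (Suc k))) k \<in> S}"
      using eq by auto
    then show ?thesis using open_prefix[of "\<lambda>u. point b (nth_default False u) k \<in> S" "Suc k"]
      by (simp add: borel_open)
  qed
  then show "(\<lambda>W. point b W k) \<in> borel_measurable coin"
    by (auto intro!: measurableI)
qed

lemma point_measurable_pair [measurable]:
  "(\<lambda>(b, W). point b W) \<in> borel_measurable (measure_pmf D \<Otimes>\<^sub>M coin)"
proof -
  have "(\<lambda>(b, W). point b W) \<in> borel_measurable (count_space UNIV \<Otimes>\<^sub>M coin)"
    by (rule measurable_pair_measure_countable1) (auto intro: point_measurable)
  then show ?thesis by (simp cong: measurable_cong_sets)
qed

lemma sets_mu [simp]: "sets mu = sets borel" and space_mu [simp]: "space mu = UNIV"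
  by (simp_all add: mu_def)

lemma prob_space_mu: "prob_space mu"
proof -
  interpret P: pair_prob_space "measure_pmf (pmf_of_set indices)" coin
    by unfold_locales
  show ?thesis unfolding mu_def by (rule P.prob_space_distr) simp
qed

sublocale mu: prob_space mu
  by (rule prob_space_mu)

lemma measure_mu:
  assumes "U \<in> sets borel"
  shows "measure mu U = (\<Sum>b\<in>indices. measure coin (point b -` U)) / 2 ^ K"
proof -
  have vim: "point b -` U \<in> sets coin" for b
    using measurable_sets[OF point_measurable assms, of b] by simp
  have "emeasure mu U = emeasure (measure_pmf (pmf_of_set indices) \<Otimes>\<^sub>M coin)
      ((\<lambda>(b, W). point b W) -` U \<inter> space (measure_pmf (pmf_of_set indices) \<Otimes>\<^sub>M coin))"
    unfolding mu_def by (rule emeasure_distr[OF point_measurable_pair assms])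
  also have "\<dots> = (\<integral>\<^sup>+b. emeasure coin (Pair b -` ((\<lambda>(b, W). point b W) -` U \<inter>
      space (measure_pmf (pmf_of_set indices) \<Otimes>\<^sub>M coin))) \<partial>measure_pmf (pmf_of_set indices))"
    by (rule coin.emeasure_pair_measure_alt) (rule measurable_sets[OF point_measurable_pair assms])
  also have "\<dots> = (\<integral>\<^sup>+b. ennreal (measure coin (point b -` U)) \<partial>measure_pmf (pmf_of_set indices))"
    by (intro nn_integral_cong) (simp add: space_pair_measure vimage_def coin.emeasure_eq_measure)
  also have "\<dots> = (\<Sum>b\<in>indices. ennreal (measure coin (point b -` U))) / card indices"
    by (rule nn_integral_pmf_of_set) (use card_indices finite_indices in \<open>auto simp: card_eq_0_iff\<close>)
  also have "\<dots> = ennreal ((\<Sum>b\<in>indices. measure coin (point b -` U)) / 2 ^ K)"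
    by (simp only: sum_ennreal measure_nonneg card_indices ennreal_of_nat_eq_real_of_nat)
      (subst divide_ennreal; simp add: sum_nonneg)
  finally show ?thesis
    by (simp add: measure_def sum_nonneg)
qed

lemma measure_mu_ge:
  assumes "U \<in> sets borel" "b \<in> indices"
  shows "measure coin (point b -` U) / 2 ^ K \<le> measure mu U"
proof -
  have "measure coin (point b -` U) \<le> (\<Sum>b\<in>indices. measure coin (point b -` U))"
    by (rule member_le_sum) (use assms finite_indices in auto)
  then show ?thesis by (simp add: measure_mu[OF assms(1)] divide_right_mono)
qed

lemma measure_mu_single_prefix:
  assumes "U \<in> sets borel" "b \<in> indices" "\<And>b'. b' \<in> indices \<Longrightarrow> b' \<noteq> b \<Longrightarrow> point b' -` U = {}"
  shows "measure mu U = measure coin (point b -` U) / 2 ^ K"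
proof -
  have "(\<Sum>b'\<in>indices. measure coin (point b' -` U)) = (\<Sum>b'\<in>{b}. measure coin (point b' -` U))"
    by (rule sum.mono_neutral_right) (use assms finite_indices in auto)
  then show ?thesis by (simp add: measure_mu[OF assms(1)])
qed

text \<open>Strings of length at most \<open>K\<close> do not determine the index \<open>b\<close>. Tests are shifted by \<open>K + 1\<close> below
  so that their measure is too small to contain such cylinders.\<close>

lemma enumerates_long_prefix:
  assumes "measure mu (Sigma1 A p i) < 1 / 2 ^ K" "point b W \<in> Sigma1 A p i" "b \<in> indices"
  shows "\<exists>t. enumerates A p i (b @ phi b W t)"
proof -
  have b: "length b = K" using assms(3) by (simp add: indices_def)
  obtain l where l: "enumerates A p i (pre (point b W) l)"
    using assms(2) unfolding mem_Sigma1 by blast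
  have "l > K"
  proof (rule ccontr)
    assume "\<not> l > K"
    then have "point b -` Sigma1 A p i = UNIV"
      using l b by (auto simp: mem_Sigma1 pre_point_short intro!: exI[of _ l])
    then have "measure coin (point b -` Sigma1 A p i) = 1"
      using measure_coin_cylinder[of "[]"] by (simp add: cylinder_def)
    then show False
      using measure_mu_ge[of "Sigma1 A p i" b] assms(1,3) open_Sigma1 by (simp add: borel_open)
  qed
  then have "pre (point b W) l = b @ phi b W (l - K)"
    using pre_point[of b W "l - K"] b by simp
  then show ?thesis using l by metis
qed

section \<open>Translation of tests between indices\<close>

lemma computable_phi:
  assumes "computable A w" "computable A n" "computable A b"
  shows "computable A (\<lambda>x. phi (b x) (nth_default False (w x)) (n x))"
proof -
  have "phi b W s = rec_nat [] (\<lambda>s u. u @ [confirm b W s (ones u)]) s" for b W s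
    by (induction s) simp_all
  then show ?thesis
    by (simp add: confirm_def ones_def)
      (intro computable_intros computable_approx computable_cls assms computable_comp[OF assms(1)]
        computable_comp[OF assms(3)])
qed

text \<open>From the confirmation times at \<open>b'\<close>, \<open>decode\<close> recovers the
  digits of \<open>W\<close> in \<open>Q b'\<close>, hence those in \<open>Q b\<close>, and
  \<open>phi b\<close> can be computed from them. So a test that catches the point at
  \<open>b\<close> yields one at \<open>b'\<close>.\<close>

lemma not_random_mono:
  assumes b: "b \<in> indices" and b': "b' \<in> indices" and sub: "Q b \<subseteq> Q b'"
    and "point b rand \<notin> MLR mu A"
  shows "point b' rand \<notin> MLR mu A"
proof -
  obtain p where p: "\<And>i. point b rand \<in> Sigma1 A p i" "\<And>i. measure mu (Sigma1 A p i) \<le> 1 / 2 ^ i"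
    using assms(4) unfolding not_MLR_iff by blast
  define d where "d u = decode (nth_default False (drop K u)) (length (drop K u))" for u
  \<comment> \<open>By the shift of \<open>K + 1\<close> the levels of \<open>p\<close> have measure
    below \<open>1 / 2 ^ K\<close>, as \<open>enumerates_long_prefix\<close> demands.\<close>
  define f where "f x = (fst x + K + 1, b @ phi b (nth_default False (d (snd x))) (length (d (snd x))))"
    for x :: "nat \<times> bool list"
  have d: "computable A (\<lambda>x. d (g x))" if "computable A g" for g :: "nat \<times> bool list \<Rightarrow> bool list"
    unfolding d_def by (intro computable_intros computable_decode that)
  \<comment> \<open>Only strings that begin with \<open>b'\<close> are kept, so that no other index
    contributes to the measure.\<close>
  have P: "computable A (\<lambda>x :: nat \<times> bool list. K \<le> length (snd x) \<and> take K (snd x) = b')"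
    by (intro computable_intros)
  have "computable A f"
    unfolding f_def by (intro computable_intros computable_phi d)
  from eval_None_restrict[OF P this, of p] obtain q where
    "\<And>x :: nat \<times> bool list. eval A q (enc x) \<noteq> None \<longleftrightarrow>
      (K \<le> length (snd x) \<and> take K (snd x) = b') \<and> eval A p (enc (f x)) \<noteq> None"
    by blast
  then have q: "enumerates A q i u \<longleftrightarrow> K \<le> length u \<and> take K u = b' \<and>
      enumerates A p (i + K + 1) (b @ phi b (nth_default False (d u)) (length (d u)))" for i u
    by (simp add: enumerates_def f_def del: enc_prod)
  have lb: "length b = K" "length b' = K"
    using b b' by (simp_all add: indices_def)
  \<comment> \<open>As many digits are decoded as were confirmed, and they determine equally many
    stages of \<open>phi b\<close>.\<close>
  have d_phi: "phi b (nth_default False (d (b' @ phi b' W t))) (length (d (b' @ phi b' W t))) =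
      phi b W (ones (phi b' W t))" for W t
  proof -
    have "d (b' @ phi b' W t) = decode (Phi b' W) t"
      unfolding d_def using lb by (auto simp: phi_eq_pre nth_default_def intro: decode_cong)
    then show ?thesis
      using sub by (auto simp: length_decode phi_eq_pre[symmetric] nth_default_def decode_Phi intro!: phi_cong)
  qed
  have sub1: "point b' -` Sigma1 A q i \<subseteq> point b -` Sigma1 A p (i + K + 1)" for i
  proof
    fix W assume "W \<in> point b' -` Sigma1 A q i"
    then obtain l where l: "K \<le> l"
      "enumerates A p (i + K + 1) (b @ phi b (nth_default False (d (pre (point b' W) l))) (length (d (pre (point b' W) l))))"
      by (auto simp: mem_Sigma1 q)
    have "pre (point b' W) l = b' @ phi b' W (l - K)"
      using pre_point[of b' W "l - K"] lb l(1) by simp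
    with l(2) have "enumerates A p (i + K + 1) (b @ phi b W (ones (phi b' W (l - K))))"
      by (simp only: d_phi)
    then show "W \<in> point b -` Sigma1 A p (i + K + 1)"
      unfolding vimage_eq mem_Sigma1 by (metis pre_point)
  qed
  have other: "point c -` Sigma1 A q i = {}" if "c \<in> indices" "c \<noteq> b'" for c i
  proof -
    have "take K (pre (point c W) l) = c" if "K \<le> l" for W l
      using \<open>c \<in> indices\<close> that by (simp add: indices_def pre_point_short min_absorb1)
    then show ?thesis using \<open>c \<noteq> b'\<close> by (auto simp: mem_Sigma1 q)
  qed
  have "measure mu (Sigma1 A q i) \<le> 1 / 2 ^ i" for i
  proof -
    have "measure mu (Sigma1 A q i) = measure coin (point b' -` Sigma1 A q i) / 2 ^ K"
      by (rule measure_mu_single_prefix) (use b' other open_Sigma1 in \<open>auto intro: borel_open\<close>)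
    also have "\<dots> \<le> measure coin (point b -` Sigma1 A p (i + K + 1)) / 2 ^ K"
      by (intro divide_right_mono coin.finite_measure_mono sub1)
        (use measurable_sets[OF point_measurable borel_open[OF open_Sigma1]] in auto)
    also have "\<dots> \<le> measure mu (Sigma1 A p (i + K + 1))"
      by (rule measure_mu_ge) (use b open_Sigma1 in \<open>auto intro: borel_open\<close>)
    also have "\<dots> \<le> 1 / 2 ^ (i + K + 1)" by (rule p(2))
    also have "\<dots> \<le> 1 / 2 ^ i" by (intro divide_left_mono power_increasing) auto
    finally show ?thesis .
  qed
  moreover have "point b' rand \<in> Sigma1 A q i" for i
  proof -
    have "1 / 2 ^ (i + K + 1) < (1 / 2 ^ K :: real)" by (intro divide_strict_left_mono power_strict_increasing) auto
    with p(2)[of "i + K + 1"] have "measure mu (Sigma1 A p (i + K + 1)) < 1 / 2 ^ K" by linarith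
    from enumerates_long_prefix[OF this p(1) b] obtain l where
      l: "enumerates A p (i + K + 1) (b @ phi b rand l)" by blast
    \<comment> \<open>Every digit of \<open>rand\<close> is confirmed in the end, so the translated
      test sees each length \<open>l\<close>.\<close>
    obtain t where t: "ones (phi b' rand t) = l" using ones_phi_rand by blast
    have "enumerates A q i (b' @ phi b' rand t)"
      using l lb unfolding q d_phi t by simp
    then show ?thesis
      unfolding mem_Sigma1 by (metis pre_point)
  qed
  ultimately show ?thesis unfolding not_MLR_iff by blast
qed

text \<open>The oracle knows column \<open>q\<close> of \<open>rand\<close>, and this column can be
  decoded from the point. Level \<open>i\<close> demands agreement in the first \<open>i\<close>
  entries, which bounds its measure by \<open>1 / 2 ^ i\<close>.\<close>

lemma not_random_if_column:
  assumes b: "b \<in> indices" and "q \<in> Q b" "q \<in> F"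
  shows "point b rand \<notin> MLR mu (keep_cols F rand)"
proof -
  let ?A = "keep_cols F rand"
  let ?c = "\<lambda>j. prod_encode (q, j)"
  have lb: "length b = K" using b by (simp add: indices_def)
  define d where "d u = decode (nth_default False (drop K u)) (length (drop K u))" for u
  have d: "computable ?A (\<lambda>x. d (g x))" if "computable ?A g" for g :: "(nat \<times> bool list) \<times> nat \<Rightarrow> bool list"
    unfolding d_def by (intro computable_intros computable_decode that)
  have P: "computable ?A (\<lambda>x :: nat \<times> bool list. K \<le> length (snd x) \<and> take K (snd x) = b \<and>
      (\<forall>j<fst x. ?c j < length (d (snd x)) \<and> nth_default False (d (snd x)) (?c j) = ?A (?c j)))"
    by (intro computable_intros d)
  \<comment> \<open>\<open>Zero\<close> halts everywhere, so the restricted domain is the decidable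
    set itself.\<close>
  from eval_None_restrict[OF P computable_id, of Zero] obtain p where
    "\<And>x :: nat \<times> bool list. eval ?A p (enc x) \<noteq> None \<longleftrightarrow> K \<le> length (snd x) \<and> take K (snd x) = b \<and>
      (\<forall>j<fst x. ?c j < length (d (snd x)) \<and> nth_default False (d (snd x)) (?c j) = ?A (?c j))"
    by auto
  then have p: "enumerates ?A p i u \<longleftrightarrow> K \<le> length u \<and> take K u = b \<and>
      (\<forall>j<i. ?c j < length (d u) \<and> nth_default False (d u) (?c j) = ?A (?c j))" for i u
    by (simp add: enumerates_def del: enc_prod)
  have A: "?A (?c j) = rand (?c j)" for j using \<open>q \<in> F\<close> by (simp add: keep_cols_def cls_def)
  have d_phi: "d (b @ phi b W t) = decode (Phi b W) t" for W t
    unfolding d_def using lb by (auto simp: phi_eq_pre nth_default_def intro: decode_cong)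
  have len: "length (decode (Phi b W) t) = ones (phi b W t)" for W t
    by (simp add: length_decode phi_eq_pre)
  have dec: "nth_default False (decode (Phi b W) t) (?c j) = W (?c j)" if "?c j < ones (phi b W t)" for W t j
    using that \<open>q \<in> Q b\<close> by (simp add: nth_default_def len decode_Phi cls_def)
  have sub: "point b -` Sigma1 ?A p i \<subseteq> {W. \<forall>k\<in>?c ` {..<i}. W k = rand k}" for i
  proof
    fix W assume "W \<in> point b -` Sigma1 ?A p i"
    then obtain l where l: "K \<le> l" "\<forall>j<i. ?c j < length (d (pre (point b W) l)) \<and>
        nth_default False (d (pre (point b W) l)) (?c j) = ?A (?c j)"
      by (auto simp: mem_Sigma1 p)
    have "pre (point b W) l = b @ phi b W (l - K)"
      using pre_point[of b W "l - K"] lb l(1) by simp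
    with l(2) show "W \<in> {W. \<forall>k\<in>?c ` {..<i}. W k = rand k}"
      using dec by (auto simp: d_phi len A)
  qed
  have other: "point c -` Sigma1 ?A p i = {}" if "c \<in> indices" "c \<noteq> b" for c i
  proof -
    have "take K (pre (point c W) l) = c" if "K \<le> l" for W l
      using \<open>c \<in> indices\<close> that by (simp add: indices_def pre_point_short min_absorb1)
    then show ?thesis using \<open>c \<noteq> b\<close> by (auto simp: mem_Sigma1 p)
  qed
  have "measure mu (Sigma1 ?A p i) \<le> 1 / 2 ^ i" for i
  proof -
    have "measure mu (Sigma1 ?A p i) = measure coin (point b -` Sigma1 ?A p i) / 2 ^ K"
      by (rule measure_mu_single_prefix) (use b other open_Sigma1 in \<open>auto intro: borel_open\<close>)
    also have "\<dots> \<le> measure coin (point b -` Sigma1 ?A p i) / 1"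
      by (intro divide_left_mono) auto
    also have "\<dots> \<le> measure coin {W. \<forall>k\<in>?c ` {..<i}. W k = rand k}"
      using sub measurable_agree[of "?c ` {..<i}" rand] by (auto intro!: coin.finite_measure_mono)
    also have "\<dots> = 1 / 2 ^ i"
      by (subst measure_coin_coordinates) (simp_all add: card_image inj_on_def)
    finally show ?thesis .
  qed
  moreover have "point b rand \<in> Sigma1 ?A p i" for i
  proof -
    obtain m where m: "\<And>j. j < i \<Longrightarrow> ?c j < m"
      using finite_nat_set_iff_bounded[of "?c ` {..<i}"] by auto
    obtain t where t: "ones (phi b rand t) = m" using ones_phi_rand by blast
    have "enumerates ?A p i (b @ phi b rand t)"
      using m lb dec by (simp add: p d_phi len t A)
    then show ?thesis
      unfolding mem_Sigma1 by (metis pre_point)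
  qed
  ultimately show ?thesis unfolding not_MLR_iff by blast
qed

text \<open>A test that catches the point pulls back along \<open>point b\<close> to a test for the
  coin measure. As \<open>phi b\<close> reads only columns in \<open>Q b\<close>, the pulled back
  test ignores those in \<open>F\<close>, and \<open>rand_passes_test\<close> applies.\<close>

lemma random_if_disjoint:
  assumes b: "b \<in> indices" and "finite F" "Q b \<inter> F = {}"
  shows "point b rand \<in> MLR mu (keep_cols F rand)"
proof (rule ccontr)
  let ?A = "keep_cols F rand"
  assume "point b rand \<notin> MLR mu ?A"
  then obtain p where p: "\<And>i. point b rand \<in> Sigma1 ?A p i" "\<And>i. measure mu (Sigma1 ?A p i) \<le> 1 / 2 ^ i"
    unfolding not_MLR_iff by blast
  have lb: "length b = K" using b by (simp add: indices_def)
  define f where "f x = (fst x + K + 1, b @ phi b (nth_default False (snd x)) (length (snd x)))"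
    for x :: "nat \<times> bool list"
  have "computable ?A f"
    unfolding f_def by (intro computable_intros computable_phi)
  from eval_None_restrict[OF computable_const[of ?A True] this, of p] obtain q where
    "\<And>x :: nat \<times> bool list. eval ?A q (enc x) \<noteq> None \<longleftrightarrow> eval ?A p (enc (f x)) \<noteq> None"
    by blast
  then have q: "enumerates ?A q i u \<longleftrightarrow>
      enumerates ?A p (i + K + 1) (b @ phi b (nth_default False u) (length u))" for i u
    by (simp add: enumerates_def f_def del: enc_prod)
  have mem: "W \<in> Sigma1 ?A q i \<longleftrightarrow> (\<exists>l. enumerates ?A p (i + K + 1) (b @ phi b W l))" for W i
    by (simp add: mem_Sigma1 q phi_nth_default_pre)
  have "measure coin (Sigma1 ?A q i) \<le> 1 / 2 ^ i" for i
  proof -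
    have "Sigma1 ?A q i \<subseteq> point b -` Sigma1 ?A p (i + K + 1)"
      unfolding vimage_def by (auto simp: mem) (metis mem_Sigma1 pre_point)
    then have "measure coin (Sigma1 ?A q i) \<le> measure coin (point b -` Sigma1 ?A p (i + K + 1))"
      by (intro coin.finite_measure_mono)
        (use measurable_sets[OF point_measurable borel_open[OF open_Sigma1]] in auto)
    \<comment> \<open>Index \<open>b\<close> has weight \<open>1 / 2 ^ K\<close> in
      \<open>mu\<close>; the shifted level pays for the factor \<open>2 ^ K\<close>.\<close>
    also have "\<dots> = 2 ^ K * (measure coin (point b -` Sigma1 ?A p (i + K + 1)) / 2 ^ K)" by simp
    also have "\<dots> \<le> 2 ^ K * measure mu (Sigma1 ?A p (i + K + 1))"
      by (intro mult_left_mono measure_mu_ge) (use b open_Sigma1 in \<open>auto intro: borel_open\<close>)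
    also have "\<dots> \<le> 2 ^ K * (1 / 2 ^ (i + K + 1))"
      by (intro mult_left_mono p(2)) simp
    also have "\<dots> = 1 / 2 ^ (i + 1)" by (simp add: power_add)
    also have "\<dots> \<le> 1 / 2 ^ i" by (intro divide_left_mono power_increasing) auto
    finally show ?thesis .
  qed
  then have test: "martin_loef_test coin ?A (Sigma1 ?A q)"
    unfolding martin_loef_test_def uniformly_Sigma1_iff by blast
  have inv: "W' \<in> Sigma1 ?A q i" if "W \<in> Sigma1 ?A q i" "\<And>k. cls k \<notin> F \<Longrightarrow> W k = W' k" for i W W'
  proof -
    have "phi b W l = phi b W' l" for l
      by (rule phi_cong) (use that(2) assms(3) in auto)
    then show ?thesis using that(1) by (simp add: mem)
  qed
  have "\<exists>i. rand \<notin> Sigma1 ?A q i"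
    by (rule rand_passes_test[OF test \<open>finite F\<close>]) (erule inv, blast)
  then obtain i where i: "rand \<notin> Sigma1 ?A q i" by blast
  have "1 / 2 ^ (i + K + 1) < (1 / 2 ^ K :: real)" by (intro divide_strict_left_mono power_strict_increasing) auto
  with p(2)[of "i + K + 1"] have "measure mu (Sigma1 ?A p (i + K + 1)) < 1 / 2 ^ K" by linarith
  from enumerates_long_prefix[OF this p(1) b] i show False
    unfolding mem by blast
qed

text \<open>\<open>decode\<close> recovers the digits in \<open>Q b\<close> from the image, so every
  such \<open>W\<close> agrees with \<open>rand\<close> on the whole infinite column
  \<open>q\<close>.\<close>

lemma point_rand_null:
  assumes "q \<in> Q b"
  shows "measure coin {W. point b W = point b rand} = 0"
proof -
  let ?c = "\<lambda>j. prod_encode (q, j)"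
  let ?S = "{W. point b W = point b rand}"
  have eq: "W k = rand k" if W: "point b W = point b rand" and "cls k \<in> Q b" for W k
  proof -
    obtain t where t: "ones (phi b rand t) = Suc k" using ones_phi_rand by blast
    have "Phi b W = Phi b rand"
    proof
      fix k
      show "Phi b W k = Phi b rand k"
        using fun_cong[OF W, of "length b + k"] by (simp add: point_def)
    qed
    then show ?thesis
      using decode_Phi[of k b W t] decode_Phi[of k b rand t] t that(2) by (simp add: phi_eq_pre)
  qed
  have "measure coin ?S \<le> 1 / 2 ^ i" for i
  proof -
    have "?S \<subseteq> {W. \<forall>k\<in>?c ` {..<i}. W k = rand k}"
    proof (clarify)
      fix W j assume "point b W = point b rand"
      then show "W (?c j) = rand (?c j)" by (rule eq) (simp add: cls_def assms)
    qed
    moreover have "{W. \<forall>k\<in>?c ` {..<i}. W k = rand k} \<in> sets coin"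
      using measurable_agree[of "?c ` {..<i}" rand] by simp
    ultimately have "measure coin ?S \<le> measure coin {W. \<forall>k\<in>?c ` {..<i}. W k = rand k}"
      by (intro coin.finite_measure_mono) auto
    also have "\<dots> = 1 / 2 ^ i"
      by (subst measure_coin_coordinates) (simp_all add: card_image inj_on_def)
    finally show ?thesis .
  qed
  then have "measure coin ?S \<le> 0"
    by (intro LIMSEQ_le_const[OF LIMSEQ_divide_realpow_zero[of 2 1]]) auto
  then show ?thesis by (simp add: measure_le_0_iff)
qed

section \<open>Atoms and the support of the measure\<close>

lemma AtomsI:
  assumes "b \<in> indices" "S \<in> sets coin" "measure coin S > 0" "\<And>W. W \<in> S \<Longrightarrow> point b W = Y"
  shows "Y \<in> Atoms mu"
proof -
  have "{Y} \<in> sets borel" by simp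
  then have "measure coin S \<le> measure coin (point b -` {Y})"
    using measurable_sets[OF point_measurable, of "{Y}" b] assms(4)
    by (intro coin.finite_measure_mono) auto
  then have "0 < measure coin (point b -` {Y}) / 2 ^ K" using assms(3) by simp
  also have "\<dots> \<le> measure mu {Y}" by (rule measure_mu_ge) (use assms(1) in auto)
  finally show ?thesis by (simp add: Atoms_def)
qed

lemma Atoms_subset_MLR: "Atoms mu \<subseteq> MLR mu A"
proof
  fix X assume "X \<in> Atoms mu"
  then have pos: "measure mu {X} > 0" by (simp add: Atoms_def)
  show "X \<in> MLR mu A"
  proof (rule ccontr)
    assume "X \<notin> MLR mu A"
    then obtain p where p: "\<And>i. X \<in> Sigma1 A p i" "\<And>i. measure mu (Sigma1 A p i) \<le> 1 / 2 ^ i"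
      unfolding not_MLR_iff by blast
    have "measure mu {X} \<le> 1 / 2 ^ i" for i
    proof -
      have "measure mu {X} \<le> measure mu (Sigma1 A p i)"
        by (intro mu.finite_measure_mono) (use p(1) open_Sigma1 in \<open>auto intro: borel_open\<close>)
      then show ?thesis using p(2)[of i] by linarith
    qed
    then have "measure mu {X} \<le> 0"
      by (intro LIMSEQ_le_const[OF LIMSEQ_divide_realpow_zero[of 2 1]]) auto
    with pos show False by simp
  qed
qed

text \<open>The test with this null cylinder as every level is enumerated from a single
  string.\<close>

lemma not_random_if_null_cylinder:
  assumes "measure mu (cylinder (pre Y l)) = 0"
  shows "Y \<notin> MLR mu A"
proof -
  have "computable A (\<lambda>x :: nat \<times> bool list. snd x = pre Y l)"
    by (intro computable_intros)
  from eval_None_restrict[OF this computable_id, of Zero] obtain p where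
    "\<And>x :: nat \<times> bool list. eval A p (enc x) \<noteq> None \<longleftrightarrow> snd x = pre Y l"
    by auto
  then have "Sigma1 A p i = cylinder (pre Y l)" for i
    by (simp add: Sigma1_def enumerates_def del: enc_prod)
  then show ?thesis
    unfolding not_MLR_iff using assms by (intro exI[of _ p]) (auto simp: cylinder_pre)
qed

lemma positive_cylinder_phi:
  assumes "measure mu (cylinder (pre Y (K + s))) > 0"
  shows "\<exists>W. phi (pre Y K) W s = pre (\<lambda>k. Y (K + k)) s"
proof -
  have "(\<Sum>b\<in>indices. measure coin (point b -` cylinder (pre Y (K + s)))) > 0"
    using assms by (simp add: measure_mu[OF borel_open[OF open_cylinder]] zero_less_divide_iff)
  then obtain b where b: "b \<in> indices" "measure coin (point b -` cylinder (pre Y (K + s))) > 0"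
    by (metis not_less sum_nonpos)
  then obtain W where W: "point b W \<in> cylinder (pre Y (K + s))"
    by (metis measure_empty ex_in_conv less_irrefl vimage_eq)
  have lb: "length b = K" using b(1) by (simp add: indices_def)
  have eq: "b @ phi b W s = pre Y (K + s)"
    using W pre_point[of b W s] lb by (simp add: cylinder_pre)
  have "pre Y (K + s) = pre Y K @ pre (\<lambda>k. Y (K + k)) s"
    by (rule nth_equalityI) (auto simp: nth_append)
  with eq have "b = pre Y K \<and> phi b W s = pre (\<lambda>k. Y (K + k)) s"
    by (metis append_eq_append_conv lb length_pre)
  then show ?thesis by metis
qed

lemma eq_pointI:
  assumes "\<And>s. phi (pre Y K) W s = pre (\<lambda>k. Y (K + k)) s"
  shows "Y = point (pre Y K) W"
proof
  fix k
  show "Y k = point (pre Y K) W k"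
  proof (cases "k < K")
    case True
    then show ?thesis by (simp add: point_def)
  next
    case False
    have "phi (pre Y K) W (Suc (k - K)) ! (k - K) = pre (\<lambda>k. Y (K + k)) (Suc (k - K)) ! (k - K)"
      by (rule arg_cong[OF assms])
    then show ?thesis using False unfolding phi_eq_pre by (simp add: point_def)
  qed
qed

text \<open>Classifies the points of the support. For every \<open>s\<close> some \<open>W s\<close>
  is mapped to \<open>Y\<close> up to stage \<open>s\<close>; the cases are whether finitely or
  infinitely many digits are confirmed along \<open>Y\<close>.\<close>

lemma positive_cylinders:
  assumes pos: "\<And>l. measure mu (cylinder (pre Y l)) > 0"
  shows "Y \<in> Atoms mu \<or> (\<exists>b\<in>indices. Q b \<noteq> {} \<and> Y = point b rand)"
proof -
  define b where "b = pre Y K"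
  have b: "b \<in> indices" by (simp add: b_def indices_def)
  define Y' where "Y' k = Y (K + k)" for k
  have "\<exists>W. phi b W s = pre Y' s" for s
    using positive_cylinder_phi[OF pos] by (simp add: b_def Y'_def[abs_def])
  then obtain W where W: "\<And>s. phi b (W s) s = pre Y' s" by metis
  have eq_point: "Y = point b V" if "\<And>s. phi b V s = pre Y' s" for V
    using that eq_pointI[of Y V] by (simp add: b_def Y'_def[abs_def])
  have pre_W: "phi b (W t) s = pre Y' s" if "s \<le> t" for s t
    using W[of t] that by (simp add: phi_eq_pre pre_eq_iff)
  show ?thesis
  proof (cases "Q b = {}")
    case True
    \<comment> \<open>Without columns the image does not depend on the argument.\<close>
    have "Y = point b V" for V
      by (rule eq_point) (use True W phi_cong[of _ b] in \<open>metis empty_iff\<close>)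
    moreover have "measure coin UNIV = 1"
      using measure_coin_cylinder[of "[]"] by (simp add: cylinder_def)
    ultimately have "Y \<in> Atoms mu"
      by (intro AtomsI[OF b, of UNIV]) auto
    then show ?thesis ..
  next
    case nonempty: False
    show ?thesis
    proof (cases "\<exists>m. \<forall>s. ones (pre Y' s) \<le> m")
      case True
      then obtain m where m: "\<And>s. ones (pre Y' s) \<le> m" by blast
      \<comment> \<open>Only the first \<open>m + 1\<close> digits are ever consulted. By pigeonhole
        one such prefix recurs for infinitely many \<open>s\<close>, and its whole cylinder is
        mapped to \<open>Y\<close>.\<close>
      have "finite (range (\<lambda>s. pre (W s) (Suc m)))"
        by (rule finite_subset[OF _ finite_strings[of "Suc m" "\<lambda>_. True"]]) auto
      then obtain s0 where inf: "infinite {s. pre (W s) (Suc m) = pre (W s0) (Suc m)}"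
        using pigeonhole_infinite[of "UNIV :: nat set"] by auto
      have "point b V = Y" if "V \<in> cylinder (pre (W s0) (Suc m))" for V
      proof (rule eq_point[symmetric])
        fix s
        obtain t where t: "t \<ge> s" "pre (W t) (Suc m) = pre (W s0) (Suc m)"
          using inf unfolding infinite_nat_iff_unbounded_le by blast
        have "V k = W t k" if "k \<le> m" for k
          using t(2) \<open>V \<in> _\<close> that by (simp add: cylinder_pre pre_eq_iff)
        then have "phi b (W t) s = phi b V s"
          using m[of s] pre_W[OF t(1)] by (intro phi_cong_le[of _ _ _ m]) auto
        then show "phi b V s = pre Y' s" using pre_W[OF t(1)] by simp
      qed
      then have "Y \<in> Atoms mu"
        by (intro AtomsI[OF b, of "cylinder (pre (W s0) (Suc m))"])
          (auto simp: measure_coin_cylinder intro: borel_open open_cylinder)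
      then show ?thesis ..
    next
      case False
      then have unbounded: "\<exists>s. m < ones (pre Y' s)" for m
        by (meson not_le)
      \<comment> \<open>Each confirmation checks all earlier digits again. Digit \<open>k\<close> is
        fixed by \<open>decode\<close>, so a confirmation after \<open>approx\<close> has settled at
        \<open>k\<close> forces the value \<open>rand k\<close>.\<close>
      have W_rand: "W t k = rand k" if k: "k < ones (pre Y' t)" "cls k \<in> Q b" for t k
      proof -
        have dec: "decode Y' s ! k = W t k" if "s \<le> t" "k < ones (pre Y' s)" for s t
        proof -
          have "pre (Phi b (W t)) s = pre Y' s" using pre_W[OF that(1)] by (simp add: phi_eq_pre)
          then have "decode (Phi b (W t)) s = decode Y' s"
            by (intro decode_cong) (simp add: pre_eq_iff)
          moreover have "decode (Phi b (W t)) s ! k = W t k"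
            by (rule decode_Phi) (use that k(2) pre_W[OF that(1)] in auto)
          ultimately show ?thesis by simp
        qed
        have same: "W t' k = W t k" if "t' \<ge> t" for t'
          using dec[of t t] dec[of t t'] that k(1) by simp
        obtain T where T: "\<And>s. s \<ge> T \<Longrightarrow> approx s k = rand k"
          using approx_tendsto_rand[of "Suc k"] by blast
        define s1 where "s1 = max T t"
        obtain s2 where s2: "ones (pre Y' s1) < ones (pre Y' s2)" using unbounded by blast
        have "\<exists>s\<ge>s1. Y' s"
        proof (rule ccontr)
          assume no: "\<not> ?thesis"
          have "ones (pre Y' (s1 + j)) = ones (pre Y' s1)" for j
            using no by (induction j) (auto simp: pre_Suc)
          then have "ones (pre Y' (max s1 s2)) = ones (pre Y' s1)"
            by (metis le_add_diff_inverse max.cobounded1)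
          then show False
            using s2 ones_pre_mono[of s2 s1 Y'] by (cases "s2 \<le> s1") (auto simp: max_def)
        qed
        then obtain s where s: "s \<ge> s1" "Y' s" by blast
        have "Phi b (W (Suc s)) s = Y' s"
          using W[of "Suc s"] by (simp add: phi_eq_pre pre_eq_iff del: phi.simps)
        then have "confirm b (W (Suc s)) s (ones (pre Y' s))"
          using s(2) pre_W[of s "Suc s"] by (simp add: Phi_def)
        moreover have "k < ones (pre Y' s)"
          using k(1) ones_pre_mono[of t s Y'] s(1) by (simp add: s1_def)
        ultimately have "W (Suc s) k = approx s k"
          using k(2) by (simp add: confirm_def Q_def)
        then show ?thesis
          using same[of "Suc s"] T[of s] s(1) by (simp add: s1_def)
      qed
      have "phi b rand s = pre Y' s" for s
      proof -
        obtain s' where s': "ones (pre Y' s) < ones (pre Y' s')" using unbounded by blast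
        then have "s \<le> s'" using ones_pre_mono[of s' s Y'] by (meson le_cases not_le)
        have "phi b (W s') s = phi b rand s"
          by (rule phi_cong_le[of _ _ _ "ones (pre Y' s)"]) (use pre_W[OF \<open>s \<le> s'\<close>] W_rand s' in auto)
        then show ?thesis using pre_W[OF \<open>s \<le> s'\<close>] by simp
      qed
      then have "Y = point b rand" by (rule eq_point)
      then show ?thesis using b nonempty by blast
    qed
  qed
qed

text \<open>Away from the finitely many special points \<open>point b rand\<close>, randomness is
  the same for all oracles.\<close>

lemma MLR_iff_Atoms:
  assumes "\<And>b. b \<in> indices \<Longrightarrow> Q b \<noteq> {} \<Longrightarrow> Y \<noteq> point b rand"
  shows "Y \<in> MLR mu A \<longleftrightarrow> Y \<in> Atoms mu"
proof
  assume "Y \<in> MLR mu A"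
  then have "measure mu (cylinder (pre Y l)) > 0" for l
    using not_random_if_null_cylinder[of Y l A] measure_nonneg[of mu] by (metis order_le_less)
  then show "Y \<in> Atoms mu" using positive_cylinders assms by blast
qed (use Atoms_subset_MLR in blast)

lemma countable_Atoms: "countable (Atoms mu)"
proof -
  have "Atoms mu = {x. measure mu {x} \<noteq> 0}"
    unfolding Atoms_def using measure_nonneg[of mu] by (auto simp: order_le_less)
  then show ?thesis using mu.countable_support by simp
qed

text \<open>By \<open>positive_cylinders\<close> the image of \<open>W\<close> can miss the atoms
  only by being \<open>point b rand\<close> with \<open>Q b\<close> nonempty, an event of
  probability 0.\<close>

lemma trivial_measure_mu: "trivial_measure mu"
proof -
  have Atoms: "Atoms mu \<in> sets borel"
    by (rule sets.countable[OF _ countable_Atoms]) simp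
  have "measure coin (point b -` Atoms mu) = 1" if b: "b \<in> indices" for b
  proof -
    have pos: "measure mu (cylinder (pre (point b W) l)) > 0" for W l
    proof -
      have lb: "length b = K" using b by (simp add: indices_def)
      have "cylinder (pre W l) \<subseteq> point b -` cylinder (pre (point b W) l)"
      proof
        fix V assume V: "V \<in> cylinder (pre W l)"
        then have "phi b V l = phi b W l"
          by (intro phi_cong) (simp add: cylinder_pre pre_eq_iff)
        then have "pre (point b V) (K + l) = pre (point b W) (K + l)"
          using pre_point[of b V l] pre_point[of b W l] lb by simp
        then show "V \<in> point b -` cylinder (pre (point b W) l)"
          by (simp add: cylinder_pre pre_eq_iff)
      qed
      then have "measure coin (cylinder (pre W l)) \<le> measure coin (point b -` cylinder (pre (point b W) l))"
        by (intro coin.finite_measure_mono)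
          (use measurable_sets[OF point_measurable borel_open[OF open_cylinder]] in auto)
      moreover have "0 < measure coin (cylinder (pre W l))"
        by (simp add: measure_coin_cylinder)
      ultimately have "0 < measure coin (point b -` cylinder (pre (point b W) l))"
        by linarith
      then have "0 < measure coin (point b -` cylinder (pre (point b W) l)) / 2 ^ K"
        by (intro divide_pos_pos) auto
      also have "\<dots> \<le> measure mu (cylinder (pre (point b W) l))"
        by (rule measure_mu_ge) (use b open_cylinder in \<open>auto intro: borel_open\<close>)
      finally show ?thesis .
    qed
    have meas: "point b -` Atoms mu \<in> sets coin"
      using measurable_sets[OF point_measurable Atoms] by simp
    have "measure coin (UNIV - point b -` Atoms mu) = 0"
    proof (cases "UNIV - point b -` Atoms mu = {}")
      case True
      then show ?thesis by (simp only: measure_empty)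
    next
      case False
      have *: "Q b \<noteq> {} \<and> point b W = point b rand" if W: "point b W \<notin> Atoms mu" for W
      proof -
        obtain c where c: "c \<in> indices" "Q c \<noteq> {}" "point b W = point c rand"
          using positive_cylinders[OF pos] W by blast
        \<comment> \<open>The first \<open>K\<close> bits name the index, so
          \<open>c = b\<close>.\<close>
        have "pre (point b W) K = b" "pre (point c rand) K = c"
          using b c(1) by (simp_all add: indices_def pre_point_short)
        then show ?thesis using c by simp
      qed
      then obtain q where "q \<in> Q b" using False by blast
      have "measure coin (UNIV - point b -` Atoms mu) \<le> measure coin {W. point b W = point b rand}"
        using * measurable_sets[OF point_measurable, of "{point b rand}" b]
        by (intro coin.finite_measure_mono) (auto simp: vimage_def)
      then show ?thesis
        using point_rand_null[OF \<open>q \<in> Q b\<close>] by (simp add: measure_le_0_iff)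
    qed
    then show ?thesis
      using coin.P.prob_compl[OF meas] by simp
  qed
  then show ?thesis
    unfolding trivial_measure_def by (simp add: measure_mu[OF Atoms] card_indices)
qed

text \<open>Cylinder measures are dyadic and found exactly by counting: \<open>n s\<close> is the
  number of pairs of an index and a string as long as \<open>s\<close> whose image begins with
  \<open>s\<close>.\<close>

lemma computable_measure_mu: "computable_measure mu"
proof -
  define n where "n s = sum_list (map (\<lambda>b. length (filter
      (\<lambda>w. take (length s) (b @ phi b (nth_default False w) (length s)) = s)
      (List.n_lists (length s) [False, True]))) (List.n_lists K [False, True]))" for s
  have measure_eq: "measure mu (cylinder s) = real (n s) / 2 ^ (K + length s)" for s
  proof -
    let ?l = "length s"
    have "measure coin (point b -` cylinder s) = card {w. length w = ?l \<and>
        take ?l (b @ phi b (nth_default False w) ?l) = s} / 2 ^ ?l" for b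
    proof -
      have "pre (point b W) ?l = take ?l (b @ phi b (nth_default False (pre W ?l)) ?l)" for W
        unfolding phi_nth_default_pre by (simp only: pre_point[symmetric] take_pre) simp
      then have "point b -` cylinder s = {W. take ?l (b @ phi b (nth_default False (pre W ?l)) ?l) = s}"
        by (auto simp: cylinder_pre)
      then show ?thesis
        using measure_coin_prefix[of "\<lambda>w. take ?l (b @ phi b (nth_default False w) ?l) = s" ?l] by simp
    qed
    moreover have "set (List.n_lists K [False, True]) = indices"
      by (auto simp: set_n_lists indices_def)
    moreover have "distinct (List.n_lists K [False, True])"
      by (intro distinct_n_lists) simp
    ultimately show ?thesis
      unfolding n_def card_strings_filter
      by (simp add: measure_mu[OF borel_open[OF open_cylinder]] sum_list_distinct_conv_sum_set
          power_add sum_divide_distrib mult.commute)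
  qed
  \<comment> \<open>The factor 2 is due to \<open>int_encode\<close>, which sends a nonnegative
    integer \<open>m\<close> to \<open>2 * m\<close>.\<close>
  have "computable (\<lambda>_. False) (\<lambda>x :: bool list \<times> nat. prod_encode (2 * n (fst x), K + length (fst x)))"
    unfolding n_def by (intro computable_intros computable_phi)
  then obtain p where p: "\<And>s i. eval (\<lambda>_. False) p (prod_encode (string_code s, i)) =
      Some (prod_encode (2 * n s, K + length s))"
    unfolding computable_def by (auto simp: enc_string)
  have dyadic: "dyadic (prod_encode (2 * m, k)) = real m / 2 ^ k" for m k
  proof -
    have "2 * m = int_encode (int m)" by (simp add: int_encode_def sum_encode_def)
    then show ?thesis by (simp add: dyadic_def)
  qed
  have "computable_dyadic (\<lambda>s i. measure mu (cylinder s))"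
    unfolding computable_dyadic_def using p by (intro exI[of _ p]) (simp add: dyadic measure_eq)
  then show ?thesis
    unfolding computable_measure_def by (intro exI[of _ "\<lambda>s i. measure mu (cylinder s)"]) simp
qed

end

section \<open>Join primes\<close>

text \<open>The first conjunct excludes the bottom element. In finite distributive lattices these
  are the join-irreducible elements.\<close>

definition join_prime :: "'a::lattice \<Rightarrow> bool" where
  "join_prime j \<longleftrightarrow> (\<exists>x. \<not> j \<le> x) \<and> (\<forall>x y. j \<le> sup x y \<longrightarrow> j \<le> x \<or> j \<le> y)"

text \<open>A minimal element among those below \<open>a\<close> and not below \<open>b\<close>
  works: were it below \<open>sup x y\<close> but below neither, distributivity would make it the
  join of two smaller elements, both below \<open>b\<close>.\<close>

lemma join_prime_separates:
  fixes a b :: "'a::{finite,distrib_lattice}"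
  assumes "\<not> a \<le> b"
  shows "\<exists>j. join_prime j \<and> j \<le> a \<and> \<not> j \<le> b"
proof -
  have "finite {x. x \<le> a \<and> \<not> x \<le> b}" "{x. x \<le> a \<and> \<not> x \<le> b} \<noteq> {}" using assms by auto
  then obtain j where j: "j \<le> a" "\<not> j \<le> b" and min: "\<And>x. x \<le> a \<Longrightarrow> \<not> x \<le> b \<Longrightarrow> x \<le> j \<Longrightarrow> x = j"
    using finite_has_minimal by (metis (mono_tags, lifting) mem_Collect_eq)
  have "j \<le> x \<or> j \<le> y" if "j \<le> sup x y" for x y
  proof (rule ccontr)
    assume "\<not> (j \<le> x \<or> j \<le> y)"
    then have "inf j x \<noteq> j" "inf j y \<noteq> j" by (metis inf.cobounded2)+
    then have "inf j x \<le> b" "inf j y \<le> b"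
      using min[of "inf j x"] min[of "inf j y"] j(1) by (meson inf.cobounded1 order_trans)+
    then have "sup (inf j x) (inf j y) \<le> b" by simp
    moreover have "j = sup (inf j x) (inf j y)"
      using that by (metis inf.absorb1 inf_sup_distrib1)
    ultimately show False using j(2) by simp
  qed
  then show ?thesis using j unfolding join_prime_def by blast
qed

text \<open>The witness is the join of \<open>S\<close>, or the bottom element if \<open>S\<close>
  is empty.\<close>

lemma join_prime_below_join:
  fixes S :: "'a::{finite,distrib_lattice} set"
  shows "\<exists>a. \<forall>j. join_prime j \<longrightarrow> (j \<le> a \<longleftrightarrow> (\<exists>k\<in>S. j \<le> k))"
proof -
  have "finite S" by simp
  then show ?thesis
  proof (induction S)
    case empty
    have "Inf_fin (UNIV :: 'a set) \<le> x" for x by (intro Inf_fin.coboundedI) auto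
    then have "\<not> j \<le> Inf_fin UNIV" if "join_prime j" for j :: 'a
      using that unfolding join_prime_def by (metis order_trans)
    then show ?case by blast
  next
    case (insert k S)
    then obtain a where "\<forall>j. join_prime j \<longrightarrow> (j \<le> a \<longleftrightarrow> (\<exists>k\<in>S. j \<le> k))" by blast
    then show ?case
      by (intro exI[of _ "sup k a"]) (auto simp: join_prime_def intro: le_supI1 le_supI2)
  qed
qed

lemma ex_inj_strings: "\<exists>K (f :: 'a::finite \<Rightarrow> bool list). inj f \<and> (\<forall>x. length (f x) = K)"
proof -
  let ?K = "CARD('a)"
  have "card (UNIV :: 'a set) \<le> card {w :: bool list. length w = ?K}"
    by (simp add: card_strings less_imp_le)
  moreover have "finite {w :: bool list. length w = ?K}" using finite_strings[of ?K "\<lambda>_. True"] by simp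
  ultimately have "\<exists>f :: 'a \<Rightarrow> bool list. range f \<subseteq> {w. length w = ?K} \<and> inj f"
    by (intro card_le_inj) auto
  then obtain f :: "'a \<Rightarrow> bool list" where "range f \<subseteq> {w. length w = ?K}" "inj f"
    by blast
  then show ?thesis by (intro exI[of _ ?K] exI[of _ f]) auto
qed

theorem theorem5p2:
  shows "\<exists>\<mu> :: cantor measure.
    prob_space \<mu> \<and> sets \<mu> = sets borel \<and> computable_measure \<mu> \<and> trivial_measure \<mu> \<and>
    order_isomorphic (LR_degrees \<mu>) (LR_degree_le \<mu>)
      (UNIV :: 'a::{finite,distrib_lattice} set) (\<le>)"
proof -
  obtain K and bits :: "'a \<Rightarrow> bool list" where bits: "inj bits" "\<And>x. length (bits x) = K"
    using ex_inj_strings by blast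
  obtain col :: "'a \<Rightarrow> nat" where col: "inj col"
    using finite_imp_inj_to_nat_seg[of "UNIV :: 'a set"] by auto
  have "finite {(bits j, col k) | j k. join_prime j \<and> join_prime k \<and> j \<le> k}"
    by (rule finite_subset[of _ "range bits \<times> range col"]) auto
  from finite_list[OF this]
  \<comment> \<open>Index \<open>bits j\<close> uses the columns of the join primes above
    \<open>j\<close>, so a smaller \<open>j\<close> uses more columns.\<close>
  obtain tab where tab: "set tab = {(bits j, col k) | j k. join_prime j \<and> join_prime k \<and> j \<le> k}"
    by (rule exE)
  interpret coding K tab .
  define X where "X j = point (bits j) rand" for j
  define S where "S A = {j. join_prime j \<and> X j \<notin> MLR mu A}" for A
  have idx: "bits j \<in> indices" for j by (simp add: indices_def bits)
  have Q: "Q (bits j) = {col k | k. join_prime j \<and> join_prime k \<and> j \<le> k}" for j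
    using bits(1) by (auto simp: Q_def tab inj_eq)
  have Q_nonempty: "\<exists>j. join_prime j \<and> b = bits j" if "Q b \<noteq> {}" for b
    using that by (auto simp: Q_def tab)
  have S_down: "j \<in> S A" if "k \<in> S A" "join_prime j" "j \<le> k" for j k A
  proof -
    have "Q (bits k) \<subseteq> Q (bits j)" using that by (auto simp: Q)
    then show ?thesis
      using that not_random_mono[OF idx idx] by (auto simp: S_def X_def)
  qed
  \<comment> \<open>Birkhoff: as a down-set of join primes, \<open>S A\<close> consists of the join
    primes below one lattice element.\<close>
  have "\<exists>a. \<forall>j. join_prime j \<longrightarrow> (j \<le> a \<longleftrightarrow> j \<in> S A)" for A
    using join_prime_below_join[of "S A"] S_down by (metis order_refl)
  then obtain g where g: "\<And>A j. join_prime j \<Longrightarrow> j \<le> g A \<longleftrightarrow> j \<in> S A" by metis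
  have LR: "LR_le mu A B \<longleftrightarrow> S A \<subseteq> S B" for A B
  proof
    assume "LR_le mu A B"
    then show "S A \<subseteq> S B" by (auto simp: LR_le_def S_def)
  next
    assume sub: "S A \<subseteq> S B"
    show "LR_le mu A B"
      unfolding LR_le_def
    proof
      fix Y assume Y: "Y \<in> MLR mu B"
      show "Y \<in> MLR mu A"
      proof (cases "\<exists>b\<in>indices. Q b \<noteq> {} \<and> Y = point b rand")
        case True
        then obtain j where "join_prime j" "Y = X j"
          using Q_nonempty by (auto simp: X_def)
        then show ?thesis using sub Y by (auto simp: S_def)
      next
        case False
        \<comment> \<open>Being random relative to \<open>B\<close> here means being an atom, which
          does not refer to the oracle.\<close>
        then show ?thesis using MLR_iff_Atoms[of Y] Y by blast
      qed
    qed
  qed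
  have le: "LR_le mu A B \<longleftrightarrow> g A \<le> g B" for A B
  proof
    assume "LR_le mu A B"
    then have "S A \<subseteq> S B" by (simp add: LR)
    show "g A \<le> g B"
    proof (rule ccontr)
      assume "\<not> g A \<le> g B"
      then obtain j where "join_prime j" "j \<le> g A" "\<not> j \<le> g B"
        using join_prime_separates by blast
      then show False using g \<open>S A \<subseteq> S B\<close> by auto
    qed
  next
    assume "g A \<le> g B"
    have "j \<in> S B" if "j \<in> S A" for j
    proof -
      have "join_prime j" using that by (simp add: S_def)
      then have "j \<le> g A" using that g by simp
      then have "j \<le> g B" using \<open>g A \<le> g B\<close> by (rule order_trans)
      then show ?thesis using \<open>join_prime j\<close> g by simp
    qed
    then have "S A \<subseteq> S B" by blast
    then show "LR_le mu A B" by (simp add: LR)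
  qed
  have surj: "\<exists>A. g A = a" for a
  proof -
    \<comment> \<open>\<open>Q (bits j)\<close> meets \<open>F\<close> iff some join prime
      \<open>k\<close> has \<open>j \<le> k\<close> and \<open>k \<le> a\<close>, that is, iff
      \<open>j \<le> a\<close>.\<close>
    define F where "F = {col k | k. join_prime k \<and> k \<le> a}"
    have "finite F" unfolding F_def by simp
    have "j \<in> S (keep_cols F rand) \<longleftrightarrow> j \<le> a" if j: "join_prime j" for j
    proof
      assume "j \<le> a"
      then have "X j \<notin> MLR mu (keep_cols F rand)"
        unfolding X_def using j by (intro not_random_if_column[OF idx, of "col j"]) (auto simp: Q F_def)
      then show "j \<in> S (keep_cols F rand)" using j by (simp add: S_def)
    next
      assume "j \<in> S (keep_cols F rand)"
      then have "X j \<notin> MLR mu (keep_cols F rand)" by (simp add: S_def)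
      then have "Q (bits j) \<inter> F \<noteq> {}"
        unfolding X_def using random_if_disjoint[OF idx \<open>finite F\<close>] by blast
      then show "j \<le> a" using col by (auto simp: Q F_def inj_eq)
    qed
    then have "\<And>j. join_prime j \<Longrightarrow> j \<le> g (keep_cols F rand) \<longleftrightarrow> j \<le> a" using g by blast
    then have "g (keep_cols F rand) = a"
      using join_prime_separates by (metis order_antisym)
    then show ?thesis by blast
  qed
  \<comment> \<open>A degree is sent to the value of \<open>g\<close> at a representative; by
    \<open>le\<close> every representative gives the same value.\<close>
  define h where "h c = g (SOME A. A \<in> c)" for c
  have h: "h (LR_equiv mu `` {A}) = g A" for A
  proof -
    have "A \<in> LR_equiv mu `` {A}" by (simp add: LR_equiv_def LR_le_def)
    then have "(SOME A'. A' \<in> LR_equiv mu `` {A}) \<in> LR_equiv mu `` {A}"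
      by (rule someI[of "\<lambda>A'. A' \<in> LR_equiv mu `` {A}"])
    then show ?thesis by (simp add: h_def LR_equiv_def le order_antisym)
  qed
  have "order_isomorphic (LR_degrees mu) (LR_degree_le mu) (UNIV :: 'a set) (\<le>)"
    unfolding order_isomorphic_def
  proof (intro exI[of _ h] conjI ballI)
    show "bij_betw h (LR_degrees mu) UNIV"
    proof (rule bij_betw_imageI)
      show "inj_on h (LR_degrees mu)"
      proof (rule inj_onI)
        fix c d assume "c \<in> LR_degrees mu" "d \<in> LR_degrees mu" "h c = h d"
        then obtain A B where "c = LR_equiv mu `` {A}" "d = LR_equiv mu `` {B}" "g A = g B"
          by (auto simp: LR_degrees_def quotient_def h)
        then show "c = d" by (simp add: LR_equiv_def le)
      qed
      show "h ` LR_degrees mu = UNIV"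
      proof (intro equalityI subsetI UNIV_I)
        fix a
        obtain A where "g A = a" using surj by blast
        then have "a = h (LR_equiv mu `` {A})" by (simp add: h)
        then show "a \<in> h ` LR_degrees mu" by (auto simp: LR_degrees_def quotient_def)
      qed
    qed
    fix c d assume "c \<in> LR_degrees mu" "d \<in> LR_degrees mu"
    then obtain A B where "c = LR_equiv mu `` {A}" "d = LR_equiv mu `` {B}"
      by (auto simp: LR_degrees_def quotient_def)
    then show "LR_degree_le mu c d \<longleftrightarrow> h c \<le> h d"
      by (simp add: LR_degree_le_class h le)
  qed
  then show ?thesis
    using prob_space_mu computable_measure_mu trivial_measure_mu by (intro exI[of _ mu]) simp
qed

end
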